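(* Let $G$ be a finite connected weighted graph with $n$ vertices, let $p>1$ and $k\in\{1,\dots,n\}$, let $f:V\to\mathbb{R}$ be an eigenfunction of the graph $p$-Laplacian $\Delta_p$ corresponding to the variational eigenvalue $\lambda_k^{(p)}$, and let $m$ be the number of strong nodal domains of $f$. Then $$\frac{2^{p-1}}{\tau(G)^{p-1}}\,\frac{h_m(G)^p}{p^p}\;\le\;\lambda_k^{(p)}\;\le\;2^{p-1}\,h_k(G),$$ where $\tau(G)=\max_{u\in V}\frac{d(u)}{\mu(u)}$ and $d(u)=\sum_{v\in V}w(uv)$ is the degree of the vertex $u$.
   Context: Graph: $G$ is a finite, connected, undirected graph with vertex set $V$, $n=|V|$, edge set $E$, strictly positive vertex weights $\mu(u)>0$ ($u\in V$) and symmetric edge weights $w(uv)=w(vu)$, with $w(uv)>0$ if $uv\in E$ and $w(uv)=0$ if $uv\notin E$. Eigenpairs: put $\Phi_p(x)=|x|^{p-2}x$ (with $\Phi_p(0)=0$) and $(\Delta_p f)(u)=\sum_{v\in V}w(uv)\Phi_p(f(u)-f(v))$ for $f:V\to\mathbb{R}$. A nonzero $f:V\to\mathbb{R}$ is an eigenfunction of $\Delta_p$ with eigenvalue $\lambda$ if $(\Delta_p f)(u)=\lambda\,\mu(u)\Phi_p(f(u))$ for all $u\in V$. Variational eigenvalues: for nonzero $f:V\to\mathbb R$ let $\mathcal{R}_p(f)=\frac12\,\frac{\sum_{u,v\in V}w(uv)|f(u)-f(v)|^p}{\sum_{u\in V}\mu(u)|f(u)|^p}$, and let $\mathcal{S}_p=\{g:V\to\mathbb{R}:\sum_{u}\mu(u)|g(u)|^p=1\}$.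 For a closed symmetric set $A=-A\subseteq\mathcal{S}_p$ the Krasnoselskii genus $\gamma(A)$ is $0$ if $A=\emptyset$, and otherwise the smallest integer $m$ for which there is a continuous odd map $h:A\to\mathbb{R}^m\setminus\{0\}$ ($\infty$ if there is none). Let $\mathcal{F}_k(\mathcal{S}_p)=\{A\subseteq\mathcal{S}_p: A=-A,\ A\text{ closed},\ \gamma(A)\ge k\}$. The variational eigenvalues are $\lambda_k^{(p)}=\min_{A\in\mathcal{F}_k(\mathcal{S}_p)}\max_{f\in A}\mathcal{R}_p(f)$, $k=1,\dots,n$. Strong nodal domains: a subset $A\subseteq V$ is a strong nodal domain of $f$ if the subgraph induced by $A$ is a maximal connected component of (the subgraph induced by) either $\{u:f(u)>0\}$ or $\{u:f(u)<0\}$. Isoperimetric constants: for nonempty $A\subseteq V$ with complement $\overline{A}=V\setminus A$, let $c(A)=\frac{w(E(A,\overline{A}))}{\mu(A)}$, where $w(E(A,\overline A))=\sum_{u\in A,\,v\in\overline A}w(uv)$ is the total weight of the edges with one endpoint in $A$ and one in $\overline A$ (each undirected edge counted once) and $\mu(A)=\sum_{u\in A}\mu(u)$. Let $\mathcal{D}_k(G)$ be the set of all families $\{A_1,\dots,A_k\}$ of $k$ nonempty, mutually disjoint subsets of $V$. Then $h_k(G)=\min_{\mathcal{A}\in\mathcal{D}_k(G)}\max_{A\in\mathcal{A}}c(A)$. *)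

theory Defs
  imports "HOL-Analysis.Analysis"
begin

text \<open>
  The vertex set is a finite type \<open>'v\<close>, so that functions on the vertices are vectors in
  \<open>real ^ 'v\<close>. Edges are unordered pairs of vertices.
\<close>

definition induces_connected :: "'v set set \<Rightarrow> 'v set \<Rightarrow> bool" where
  "induces_connected E A \<longleftrightarrow>
     A \<noteq> {} \<and> (\<forall>u\<in>A. \<forall>v\<in>A. (u, v) \<in> {(x, y). x \<in> A \<and> y \<in> A \<and> {x, y} \<in> E}\<^sup>*)"

text \<open>Loops \<open>{u}\<close> are not excluded; they contribute only to the degree of \<open>u\<close>.\<close>

locale connected_weighted_graph =
  fixes E :: "'v::finite set set"
    and \<mu> :: "'v \<Rightarrow> real"
    and w :: "'v \<Rightarrow> 'v \<Rightarrow> real"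
  assumes edges: "e \<in> E \<Longrightarrow> \<exists>u v. e = {u, v}"
    and connected: "induces_connected E UNIV"
    and vertex_weight_pos: "\<mu> u > 0"
    and edge_weight_sym: "w u v = w v u"
    and edge_weight_pos: "{u, v} \<in> E \<Longrightarrow> w u v > 0"
    and edge_weight_zero: "{u, v} \<notin> E \<Longrightarrow> w u v = 0"

definition Phi :: "real \<Rightarrow> real \<Rightarrow> real" where
  "Phi p x = \<bar>x\<bar> powr (p - 2) * x"

definition p_Laplacian ::
    "('v::finite \<Rightarrow> 'v \<Rightarrow> real) \<Rightarrow> real \<Rightarrow> real ^ 'v \<Rightarrow> real ^ 'v" where
  "p_Laplacian w p f = (\<chi> u. \<Sum>v\<in>UNIV. w u v * Phi p (f $ u - f $ v))"

definition is_eigenfunction ::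
    "('v::finite \<Rightarrow> real) \<Rightarrow> ('v \<Rightarrow> 'v \<Rightarrow> real) \<Rightarrow> real \<Rightarrow> real \<Rightarrow> real ^ 'v \<Rightarrow> bool" where
  "is_eigenfunction \<mu> w p l f \<longleftrightarrow>
     f \<noteq> 0 \<and> (\<forall>u. p_Laplacian w p f $ u = l * \<mu> u * Phi p (f $ u))"

definition rayleigh ::
    "('v::finite \<Rightarrow> real) \<Rightarrow> ('v \<Rightarrow> 'v \<Rightarrow> real) \<Rightarrow> real \<Rightarrow> real ^ 'v \<Rightarrow> real" where
  "rayleigh \<mu> w p f =
     1 / 2 * ((\<Sum>u\<in>UNIV. \<Sum>v\<in>UNIV. w u v * \<bar>f $ u - f $ v\<bar> powr p) /
              (\<Sum>u\<in>UNIV. \<mu> u * \<bar>f $ u\<bar> powr p))"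

definition p_sphere :: "('v::finite \<Rightarrow> real) \<Rightarrow> real \<Rightarrow> (real ^ 'v) set" where
  "p_sphere \<mu> p = {g. (\<Sum>u\<in>UNIV. \<mu> u * \<bar>g $ u\<bar> powr p) = 1}"

text \<open>
  \<open>Euclidean_space m\<close> is $\mathbb{R}^m$ as a space of sequences vanishing from index \<open>m\<close> on.
  The infimum of the empty set of extended naturals is \<open>\<infinity>\<close>.
\<close>

definition has_odd_map :: "'a::real_normed_vector set \<Rightarrow> nat \<Rightarrow> bool" where
  "has_odd_map A m \<longleftrightarrow>
     (\<exists>h. continuous_map (top_of_set A) (Euclidean_space m) h \<and>
          (\<forall>x\<in>A. \<forall>i. h (- x) i = - h x i) \<and>
          (\<forall>x\<in>A. h x \<noteq> (\<lambda>i. 0)))"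

definition genus :: "'a::real_normed_vector set \<Rightarrow> enat" where
  "genus A = (if A = {} then 0 else Inf {enat m | m. has_odd_map A m})"

text \<open>Since the sphere is closed, closedness in the sphere and in the whole space agree.\<close>

definition genus_family :: "('v::finite \<Rightarrow> real) \<Rightarrow> real \<Rightarrow> nat \<Rightarrow> (real ^ 'v) set set" where
  "genus_family \<mu> p k =
     {A. A \<subseteq> p_sphere \<mu> p \<and> uminus ` A = A \<and> closed A \<and> genus A \<ge> enat k}"

text \<open>
  For \<open>p > 1\<close> and \<open>1 \<le> k \<le> CARD('v)\<close> the family is nonempty and consists of nonempty compact
  sets, the Rayleigh quotient is continuous on the sphere, and both extrema are attained
  (the outer one because the genus is unchanged in a small closed symmetric neighbourhood of a
  compact symmetric set), so the infimum and supremum below are a minimum and a maximum.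
\<close>

definition variational_eigenvalue ::
    "('v::finite \<Rightarrow> real) \<Rightarrow> ('v \<Rightarrow> 'v \<Rightarrow> real) \<Rightarrow> real \<Rightarrow> nat \<Rightarrow> real" where
  "variational_eigenvalue \<mu> w p k =
     (INF A\<in>genus_family \<mu> p k. SUP f\<in>A. rayleigh \<mu> w p f)"

definition is_component_of :: "'v set set \<Rightarrow> 'v set \<Rightarrow> 'v set \<Rightarrow> bool" where
  "is_component_of E S A \<longleftrightarrow>
     A \<subseteq> S \<and> induces_connected E A \<and>
     (\<forall>B. A \<subseteq> B \<and> B \<subseteq> S \<and> induces_connected E B \<longrightarrow> B = A)"

definition strong_nodal_domains :: "'v::finite set set \<Rightarrow> real ^ 'v \<Rightarrow> 'v set set" where
  "strong_nodal_domains E f =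
     {A. is_component_of E {u. f $ u > 0} A \<or> is_component_of E {u. f $ u < 0} A}"

definition cut_ratio ::
    "('v::finite \<Rightarrow> real) \<Rightarrow> ('v \<Rightarrow> 'v \<Rightarrow> real) \<Rightarrow> 'v set \<Rightarrow> real" where
  "cut_ratio \<mu> w A = (\<Sum>u\<in>A. \<Sum>v\<in>- A. w u v) / (\<Sum>u\<in>A. \<mu> u)"

definition disjoint_families :: "nat \<Rightarrow> 'v::finite set set set" where
  "disjoint_families k = {\<A>. card \<A> = k \<and> {} \<notin> \<A> \<and> disjoint \<A>}"

definition isoperimetric_constant ::
    "('v::finite \<Rightarrow> real) \<Rightarrow> ('v \<Rightarrow> 'v \<Rightarrow> real) \<Rightarrow> nat \<Rightarrow> real" where
  "isoperimetric_constant \<mu> w k =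
     Min ((\<lambda>\<A>. Max (cut_ratio \<mu> w ` \<A>)) ` disjoint_families k)"

definition vertex_degree :: "('v::finite \<Rightarrow> 'v \<Rightarrow> real) \<Rightarrow> 'v \<Rightarrow> real" where
  "vertex_degree w u = (\<Sum>v\<in>UNIV. w u v)"

definition max_degree_ratio ::
    "('v::finite \<Rightarrow> real) \<Rightarrow> ('v \<Rightarrow> 'v \<Rightarrow> real) \<Rightarrow> real" where
  "max_degree_ratio \<mu> w = Max (range (\<lambda>u. vertex_degree w u / \<mu> u))"

end

theory Submission
  imports Defs "HOL-Homology.Homology"
begin

text \<open>
  Write $\lambda$ for the variational eigenvalue $\lambda_k^{(p)}$ and $\tau$ for $\tau(G)$. The
  lower bound is a property of any eigenvalue with an eigenfunction that has \<open>m\<close> nodal domains; the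
  upper bound tests the minimax that defines $\lambda$ with one explicit set.

  Lower bound. Let \<open>A\<close> be a strong nodal domain of the eigenfunction \<open>f\<close> and let
  \<open>g\<close> be \<open>\<bar>f\<bar>\<close> cut off outside \<open>A\<close>. Testing the eigenvalue equation with \<open>g\<close> shows that
  the Rayleigh quotient of \<open>g\<close> is at most $\lambda$: an edge leaving \<open>A\<close> ends where \<open>f\<close> vanishes
  or has the opposite sign, so cutting off only lowers the energy (\<open>energy_on_component\<close>). Now apply
  the co-area inequality to $g^p$. If \<open>B\<close> minimises the cut ratio \<open>c(B)\<close> among the nonempty
  subsets of \<open>A\<close>, then
  $$c(B) \sum_u \mu(u) g(u)^p \le \tfrac12 \sum_{u,v} w(uv) |g(u)^p - g(v)^p|.$$
  The right-hand side is estimated by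
  $|a^p-b^p| \le s|a-b|^p + (p-1)s^{-1/(p-1)}(a^p+b^p)/2$, valid for every $s>0$, whose two terms sum
  to the energy and to a weighted degree sum. This gives
  $c(B) \le s\lambda + (p-1)s^{-1/(p-1)}\tau/2$ (\<open>Cheeger_sweep\<close>). The stated
  constant is the result of minimising over \<open>s\<close> at the very end. The \<open>m\<close> nodal domains are disjoint, hence so are
  their sets \<open>B\<close>, and $h_m(G)$ is at most the largest of their cut ratios.

  Upper bound. Let $A_1,\dots,A_k$ be disjoint sets attaining $h_k(G)$. On functions that are constant
  on each $A_i$ and vanish elsewhere, convexity of $|x|^p$ bounds the Rayleigh quotient by
  $2^{p-1}h_k(G)$ (\<open>block_constant_energy_le\<close>). These functions form a \<open>k\<close>-dimensional space, and
  its intersection with the \<open>p\<close>-sphere is an odd image of the Euclidean sphere of dimension \<open>k-1\<close>;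
  by the Borsuk-Ulam theorem its genus is at least \<open>k\<close>, so it competes in the minimax.

  Borsuk-Ulam is derived from the fact that every odd self-map of a sphere has odd degree
  (\<open>Borsuk_odd_map_odd_degree\<close>). The proof is an induction on the dimension: a map that
  preserves the equator has the same degree mod 2 as its restriction to the equator. To
  reach this situation, approximate the map by an odd polynomial map, whose restriction to the
  equator cannot be onto for reasons of dimension; reflect an omitted point into the pole; and push
  the image of the equator away from both poles onto the equator. Approximating and pushing never lead
  to antipodal values, so they preserve the degree; the reflection multiplies it by an odd factor.
\<close>

section \<open>Odd maps of spheres\<close>

text \<open>
  An enumeration of the basis turns unit spheres of coordinate subspaces into the spheres
  \<open>nsphere d\<close> of sequences, on which the Brouwer degree is defined. Approximation by polynomials and
  the dimension argument for smooth maps take place in the Euclidean space.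
\<close>

locale enumerated_basis =
  fixes b :: "nat \<Rightarrow> 'a::euclidean_space"
  assumes bij_b: "bij_betw b {..<DIM('a)} Basis"
begin

definition coord_space :: "nat \<Rightarrow> 'a set" where
  "coord_space k = {x. \<forall>i. k \<le> i \<and> i < DIM('a) \<longrightarrow> x \<bullet> b i = 0}"

definition coord_sphere :: "nat \<Rightarrow> 'a set" where
  "coord_sphere k = sphere 0 1 \<inter> coord_space k"

definition coords :: "'a \<Rightarrow> nat \<Rightarrow> real" where
  "coords x i = (if i < DIM('a) then x \<bullet> b i else 0)"

definition vec_of :: "(nat \<Rightarrow> real) \<Rightarrow> 'a" where
  "vec_of c = (\<Sum>i<DIM('a). c i *\<^sub>R b i)"

text \<open>
  The sphere of dimension \<open>d\<close> lies in \<open>coord_space (Suc d)\<close>; hence the shift by one between the two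
  indices throughout.
\<close>

definition sphere_degree :: "nat \<Rightarrow> ('a \<Rightarrow> 'a) \<Rightarrow> int" where
  "sphere_degree d g = Brouwer_degree2 d (coords \<circ> g \<circ> vec_of)"

lemma b_in_Basis: "i < DIM('a) \<Longrightarrow> b i \<in> Basis"
  using bij_b by (auto simp: bij_betw_def)

lemma inner_b:
  assumes "i < DIM('a)" "j < DIM('a)"
  shows "b i \<bullet> b j = (if i = j then 1 else 0)"
proof -
  have "b i = b j \<longleftrightarrow> i = j"
    using bij_b assms by (auto simp: bij_betw_def inj_on_def)
  then show ?thesis
    using assms b_in_Basis by (auto simp: inner_Basis)
qed

lemma vec_of_coords [simp]: "vec_of (coords x) = x"
proof -
  have "vec_of (coords x) = (\<Sum>i<DIM('a). (x \<bullet> b i) *\<^sub>R b i)"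
    unfolding vec_of_def coords_def by (intro sum.cong) auto
  also have "\<dots> = (\<Sum>e\<in>Basis. (x \<bullet> e) *\<^sub>R e)"
    by (rule sum.reindex_bij_betw [OF bij_b])
  finally show ?thesis
    by (simp add: euclidean_representation)
qed

lemma inner_vec_of:
  assumes "j < DIM('a)"
  shows "vec_of c \<bullet> b j = c j"
proof -
  have "vec_of c \<bullet> b j = (\<Sum>i<DIM('a). c i * (if i = j then 1 else 0))"
    unfolding vec_of_def inner_sum_left using assms inner_b by (intro sum.cong) auto
  also have "\<dots> = (\<Sum>i<DIM('a). if i = j then c i else 0)"
    by (intro sum.cong) auto
  also have "\<dots> = c j"
    using assms by simp
  finally show ?thesis .
qed

lemma coords_vec_of: "(\<And>i. i \<ge> DIM('a) \<Longrightarrow> c i = 0) \<Longrightarrow> coords (vec_of c) = c"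
  by (auto simp: coords_def inner_vec_of fun_eq_iff)

lemma norm_eq_coords: "(norm x)\<^sup>2 = (\<Sum>i<DIM('a). (x \<bullet> b i)\<^sup>2)"
proof -
  have "(\<Sum>i<DIM('a). (x \<bullet> b i)\<^sup>2) = (\<Sum>e\<in>Basis. (x \<bullet> e)\<^sup>2)"
    by (rule sum.reindex_bij_betw [OF bij_b])
  then show ?thesis
    using euclidean_inner[of x x] by (simp add: dot_square_norm flip: power2_eq_square)
qed

lemma subspace_coord_space: "subspace (coord_space k)"
  by (auto simp: coord_space_def subspace_def inner_add_left)

lemma coord_space_mono: "k \<le> l \<Longrightarrow> coord_space k \<subseteq> coord_space l"
  by (auto simp: coord_space_def)

lemma dim_coord_space:
  assumes "k \<le> DIM('a)"
  shows "dim (coord_space k) = k"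
proof -
  have inj: "inj_on b {..<DIM('a)}" and im: "b ` {..<DIM('a)} = Basis"
    using bij_b by (auto simp: bij_betw_def)
  have sub: "b ` {..<k} \<subseteq> Basis"
    using assms im by force
  have nin: "b j \<notin> b ` {..<k} \<longleftrightarrow> k \<le> j" if "j < DIM('a)" for j
  proof -
    have "b j \<in> b ` {..<k} \<longleftrightarrow> j \<in> {..<k}"
      using assms that by (intro inj_on_image_mem_iff[OF inj]) auto
    then show ?thesis by auto
  qed
  have "(\<forall>i\<in>Basis. i \<notin> b ` {..<k} \<longrightarrow> x \<bullet> i = 0) \<longleftrightarrow> x \<in> coord_space k" for x
  proof -
    have "(\<forall>i\<in>Basis. Q i) \<longleftrightarrow> (\<forall>j<DIM('a). Q (b j))" for Q
      using im by (metis imageE imageI lessThan_iff)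
    from this[of "\<lambda>i. i \<notin> b ` {..<k} \<longrightarrow> x \<bullet> i = 0"] show ?thesis
      unfolding coord_space_def using nin by auto
  qed
  then have "coord_space k = {x. \<forall>i\<in>Basis. i \<notin> b ` {..<k} \<longrightarrow> x \<bullet> i = 0}"
    by auto
  then have "dim (coord_space k) = card (b ` {..<k})"
    using dim_substandard[OF sub] by simp
  also have "\<dots> = k"
    using inj assms by (simp add: card_image inj_on_subset)
  finally show ?thesis .
qed

lemma uminus_coord_sphere: "x \<in> coord_sphere k \<Longrightarrow> - x \<in> coord_sphere k"
  by (auto simp: coord_sphere_def coord_space_def)

lemma normalize_in_coord_sphere:
  "x \<in> coord_space k \<Longrightarrow> x \<noteq> 0 \<Longrightarrow> x /\<^sub>R norm x \<in> coord_sphere k"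
  by (auto simp: coord_sphere_def intro!: subspace_mul subspace_coord_space)

lemma coord_sphere_iff:
  assumes "d < DIM('a)"
  shows "coords x \<in> topspace (nsphere d) \<longleftrightarrow> x \<in> coord_sphere (Suc d)"
proof -
  have "norm x = 1 \<longleftrightarrow> (\<Sum>i\<le>d. (coords x i)\<^sup>2) = 1" if "\<forall>i>d. coords x i = 0"
  proof -
    have "(norm x)\<^sup>2 = (\<Sum>i<DIM('a). (coords x i)\<^sup>2)"
      unfolding norm_eq_coords coords_def by (intro sum.cong) auto
    also have "\<dots> = (\<Sum>i\<le>d. (coords x i)\<^sup>2)"
      by (rule sum.mono_neutral_right) (use assms that in auto)
    finally have "(norm x)\<^sup>2 = (\<Sum>i\<le>d. (coords x i)\<^sup>2)" .
    then show ?thesis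
      by (metis norm_ge_zero one_power2 power2_eq_imp_eq zero_le_one)
  qed
  moreover have "(\<forall>i>d. coords x i = 0) \<longleftrightarrow> x \<in> coord_space (Suc d)"
    by (auto simp: coords_def coord_space_def)
  ultimately show ?thesis
    by (auto simp: nsphere coord_sphere_def)
qed

lemma nsphere_coords_vec_of:
  assumes "d < DIM('a)" "c \<in> topspace (nsphere d)"
  shows "coords (vec_of c) = c"
  using assms by (intro coords_vec_of) (auto simp: nsphere)

lemma vec_of_in_coord_sphere:
  assumes "d < DIM('a)" "c \<in> topspace (nsphere d)"
  shows "vec_of c \<in> coord_sphere (Suc d)"
  using assms coord_sphere_iff nsphere_coords_vec_of by metis

lemma coords_uminus: "coords (- x) = (\<lambda>i. - coords x i)"
  by (auto simp: coords_def)

lemma vec_of_uminus: "vec_of (\<lambda>i. - c i) = - vec_of c"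
  by (simp add: vec_of_def sum_negf)

lemma continuous_map_coords:
  assumes "d < DIM('a)"
  shows "continuous_map (top_of_set (coord_sphere (Suc d))) (nsphere d) coords"
proof -
  have *: "continuous_on (coord_sphere (Suc d)) (\<lambda>x. coords x i)" for i
    unfolding coords_def by (cases "i < DIM('a)") (auto intro!: continuous_intros)
  have "coords ` coord_sphere (Suc d) \<subseteq> {x. (\<Sum>i\<le>d. (x i)\<^sup>2) = 1 \<and> (\<forall>i>d. x i = 0)}"
    using coord_sphere_iff[OF assms] by (auto simp: nsphere)
  with * show ?thesis
    unfolding nsphere continuous_map_in_subtopology continuous_map_componentwise_UNIV
    by auto
qed

lemma continuous_map_vec_of:
  assumes "d < DIM('a)"
  shows "continuous_map (nsphere d) (top_of_set (coord_sphere (Suc d))) vec_of"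
proof -
  have "continuous_map (nsphere d) euclidean (\<lambda>c. c i *\<^sub>R b i)" for i
  proof -
    have "continuous_map euclideanreal euclidean (\<lambda>t. t *\<^sub>R b i)"
      by (auto intro!: continuous_intros)
    from continuous_map_compose[OF continuous_map_nsphere_projection this] show ?thesis
      by (simp add: o_def)
  qed
  then have "continuous_map (nsphere d) euclidean vec_of"
    unfolding vec_of_def by (intro continuous_map_sum) auto
  then show ?thesis
    using vec_of_in_coord_sphere[OF assms]
    by (auto simp: continuous_map_in_subtopology)
qed

lemma continuous_map_conj:
  assumes "d < DIM('a)" "continuous_on (coord_sphere (Suc d)) g"
    "g \<in> coord_sphere (Suc d) \<rightarrow> coord_sphere (Suc d)"
  shows "continuous_map (nsphere d) (nsphere d) (coords \<circ> g \<circ> vec_of)"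
proof -
  have "continuous_map (top_of_set (coord_sphere (Suc d))) (top_of_set (coord_sphere (Suc d))) g"
    using assms by auto
  then show ?thesis
    using continuous_map_coords continuous_map_vec_of assms(1) continuous_map_compose by metis
qed

lemma sphere_degree_compose:
  assumes d: "d < DIM('a)"
    and g: "continuous_on (coord_sphere (Suc d)) g" "g \<in> coord_sphere (Suc d) \<rightarrow> coord_sphere (Suc d)"
    and h: "continuous_on (coord_sphere (Suc d)) h" "h \<in> coord_sphere (Suc d) \<rightarrow> coord_sphere (Suc d)"
  shows "sphere_degree d (h \<circ> g) = sphere_degree d h * sphere_degree d g"
proof -
  have "sphere_degree d h * sphere_degree d g
      = Brouwer_degree2 d ((coords \<circ> h \<circ> vec_of) \<circ> (coords \<circ> g \<circ> vec_of))"
    unfolding sphere_degree_def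
    by (rule Brouwer_degree2_compose[symmetric]) (use continuous_map_conj assms in auto)
  also have "(coords \<circ> h \<circ> vec_of) \<circ> (coords \<circ> g \<circ> vec_of) = coords \<circ> (h \<circ> g) \<circ> vec_of"
    by (auto simp: fun_eq_iff)
  finally show ?thesis
    by (simp only: sphere_degree_def)
qed

text \<open>
  The degree of an involution squares to \<open>1\<close>. This covers the sphere of dimension \<open>0\<close>, where every
  odd map is an involution, and reflections.
\<close>

lemma odd_degree_involution:
  assumes d: "d < DIM('a)"
    and g: "continuous_on (coord_sphere (Suc d)) g" "g \<in> coord_sphere (Suc d) \<rightarrow> coord_sphere (Suc d)"
    and inv: "\<And>x. x \<in> coord_sphere (Suc d) \<Longrightarrow> g (g x) = x"
  shows "odd (sphere_degree d g)"
proof -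
  have "sphere_degree d g * sphere_degree d g = sphere_degree d (g \<circ> g)"
    using sphere_degree_compose[OF d g g] by simp
  also have "\<dots> = Brouwer_degree2 d id"
    unfolding sphere_degree_def
    by (rule Brouwer_degree2_eq) (use inv vec_of_in_coord_sphere[OF d] nsphere_coords_vec_of[OF d] in auto)
  also have "\<dots> = 1"
    by simp
  finally show ?thesis
    by (metis dvd_triv_left odd_one dvd_trans)
qed

text \<open>
  If \<open>h x\<close> is never antipodal to \<open>g x\<close>, then the segment from \<open>g x\<close> to \<open>h x\<close> misses the origin, and
  normalising the straight-line homotopy gives a homotopy on the sphere.
\<close>

lemma sphere_degree_cong_nonantipodal:
  assumes d: "d < DIM('a)"
    and g: "continuous_on (coord_sphere (Suc d)) g" "g \<in> coord_sphere (Suc d) \<rightarrow> coord_sphere (Suc d)"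
    and h: "continuous_on (coord_sphere (Suc d)) h" "h \<in> coord_sphere (Suc d) \<rightarrow> coord_sphere (Suc d)"
    and na: "\<And>x. x \<in> coord_sphere (Suc d) \<Longrightarrow> h x \<noteq> - g x"
  shows "sphere_degree d g = sphere_degree d h"
proof -
  let ?S = "coord_sphere (Suc d)" and ?V = "coord_space (Suc d)"
  define nrm where "nrm = (\<lambda>x::'a. x /\<^sub>R norm x)"
  have n1: "norm (g x) = 1" "norm (h x) = 1" if "x \<in> ?S" for x
    using g h that by (auto simp: coord_sphere_def Pi_iff)
  have "homotopic_with_canon (\<lambda>x. True) ?S (?V - {0}) g h"
  proof (rule homotopic_with_linear [OF g(1) h(1)])
    fix x assume x: "x \<in> ?S"
    have "closed_segment (g x) (h x) \<subseteq> ?V"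
      using g(2) h(2) x subspace_imp_convex[OF subspace_coord_space]
      by (intro closed_segment_subset) (auto simp: coord_sphere_def Pi_iff)
    moreover have "0 \<notin> closed_segment (g x) (h x)"
    proof
      assume "0 \<in> closed_segment (g x) (h x)"
      then obtain t where t: "0 \<le> t" "t \<le> 1" "(1 - t) *\<^sub>R g x + t *\<^sub>R h x = 0"
        by (auto simp: in_segment)
      then have e: "t *\<^sub>R h x = - ((1 - t) *\<^sub>R g x)"
        by (simp add: add_eq_0_iff)
      then have "norm (t *\<^sub>R h x) = norm ((1 - t) *\<^sub>R g x)"
        by (simp only: norm_minus_cancel)
      then have "t = 1 - t"
        using n1[OF x] t by simp
      then have "t = 1/2" by simp
      with e have "(1/2) *\<^sub>R h x = (1/2) *\<^sub>R (- g x)"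
        by simp
      then have "h x = - g x"
        by (simp only: scaleR_cancel_left) simp
      with na[OF x] show False by simp
    qed
    ultimately show "closed_segment (g x) (h x) \<subseteq> ?V - {0}" by auto
  qed
  moreover have "continuous_map (top_of_set (?V - {0})) (top_of_set ?S) nrm"
    by (auto simp: nrm_def coord_sphere_def intro!: continuous_intros subspace_mul[OF subspace_coord_space])
  ultimately have "homotopic_with (\<lambda>x. True) (top_of_set ?S) (top_of_set ?S) (nrm \<circ> g) (nrm \<circ> h)"
    by (rule homotopic_with_compose_continuous_map_left) auto
  then have "homotopic_with (\<lambda>x. True) (top_of_set ?S) (nsphere d) (coords \<circ> (nrm \<circ> g)) (coords \<circ> (nrm \<circ> h))"
    by (rule homotopic_with_compose_continuous_map_left) (use continuous_map_coords d in auto)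
  then have "homotopic_with (\<lambda>x. True) (nsphere d) (nsphere d)
      (coords \<circ> (nrm \<circ> g) \<circ> vec_of) (coords \<circ> (nrm \<circ> h) \<circ> vec_of)"
    by (rule homotopic_with_compose_continuous_map_right) (use continuous_map_vec_of d in auto)
  then have "sphere_degree d (nrm \<circ> g) = sphere_degree d (nrm \<circ> h)"
    unfolding sphere_degree_def by (rule Brouwer_degree2_homotopic)
  moreover have "sphere_degree d (nrm \<circ> g) = sphere_degree d g" "sphere_degree d (nrm \<circ> h) = sphere_degree d h"
    unfolding sphere_degree_def
    by (rule Brouwer_degree2_eq; simp add: nrm_def n1 vec_of_in_coord_sphere d)+
  ultimately show ?thesis by simp
qed

lemma even_degree_diff_equator:
  assumes d: "Suc d < DIM('a)"
    and g: "continuous_on (coord_sphere (Suc (Suc d))) g"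
      "g \<in> coord_sphere (Suc (Suc d)) \<rightarrow> coord_sphere (Suc (Suc d))"
    and odd: "\<And>x. x \<in> coord_sphere (Suc (Suc d)) \<Longrightarrow> g (- x) = - g x"
    and eq: "g \<in> coord_sphere (Suc d) \<rightarrow> coord_sphere (Suc d)"
  shows "even (sphere_degree (Suc d) g - sphere_degree d g)"
proof -
  have "even (Brouwer_degree2 (Suc d) (coords \<circ> g \<circ> vec_of)
             - Brouwer_degree2 (Suc d - Suc 0) (coords \<circ> g \<circ> vec_of))"
  proof (rule Borsuk_odd_mapping_degree_step)
    show "continuous_map (nsphere (Suc d)) (nsphere (Suc d)) (coords \<circ> g \<circ> vec_of)"
      by (rule continuous_map_conj[OF d g])
    fix u assume "u \<in> topspace (nsphere (Suc d))"
    then show "(coords \<circ> g \<circ> vec_of \<circ> (\<lambda>x i. - x i)) u = ((\<lambda>x i. - x i) \<circ> (coords \<circ> g \<circ> vec_of)) u"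
      using vec_of_in_coord_sphere[OF d] by (simp add: vec_of_uminus odd coords_uminus)
  next
    have "d < DIM('a)" using d by simp
    then show "coords \<circ> g \<circ> vec_of \<in> topspace (nsphere (Suc d - Suc 0)) \<rightarrow> topspace (nsphere (Suc d - Suc 0))"
      using eq vec_of_in_coord_sphere coord_sphere_iff by (simp add: Pi_iff)
  qed
  then show ?thesis
    by (simp add: sphere_degree_def)
qed

text \<open>
  General position for odd maps: a smooth map takes the equator, which has smaller dimension, to a
  proper subset of the sphere. Taking the odd part \<open>(P x - P (- x)) / 2\<close> of a polynomial
  approximation \<open>P\<close> keeps the error bound, because the approximated map is itself odd.
\<close>

lemma odd_approximation_omitting_axis:
  assumes d: "Suc d < DIM('a)"
    and g: "continuous_on (coord_sphere (Suc (Suc d))) g"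
      "g \<in> coord_sphere (Suc (Suc d)) \<rightarrow> coord_sphere (Suc (Suc d))"
    and odd: "\<And>x. x \<in> coord_sphere (Suc (Suc d)) \<Longrightarrow> g (- x) = - g x"
  obtains h a where "continuous_on (coord_sphere (Suc (Suc d))) h"
      "h \<in> coord_sphere (Suc (Suc d)) \<rightarrow> coord_sphere (Suc (Suc d))"
      "\<And>x. x \<in> coord_sphere (Suc (Suc d)) \<Longrightarrow> h (- x) = - h x"
      "\<And>x. x \<in> coord_sphere (Suc (Suc d)) \<Longrightarrow> h x \<noteq> - g x"
      "a \<in> coord_sphere (Suc (Suc d))" "a \<notin> h ` coord_sphere (Suc d)"
proof -
  let ?S = "coord_sphere (Suc (Suc d))" and ?V = "coord_space (Suc (Suc d))"
  have cpt: "compact ?S"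
    unfolding coord_sphere_def
    by (simp add: compact_Int_closed closed_subspace subspace_coord_space)
  obtain P where P: "polynomial_function P" "P ` ?S \<subseteq> ?V" "\<And>x. x \<in> ?S \<Longrightarrow> norm (g x - P x) < 1"
    using Stone_Weierstrass_polynomial_function_subspace[OF cpt g(1) zero_less_one subspace_coord_space[of "Suc (Suc d)"]] g(2)
    by (auto simp: coord_sphere_def image_subset_iff Pi_iff)
  define Q where "Q = (\<lambda>x. (1/2) *\<^sub>R (P x - P (- x)))"
  define h where "h = (\<lambda>x. Q x /\<^sub>R norm (Q x))"
  have Qodd: "Q (- x) = - Q x" for x
    by (simp add: Q_def algebra_simps)
  have QV: "Q x \<in> ?V" if "x \<in> ?S" for x
    unfolding Q_def using P(2) that uminus_coord_sphere[OF that]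
    by (intro subspace_mul subspace_diff subspace_coord_space) auto
  have Qg: "norm (g x - Q x) < 1" if "x \<in> ?S" for x
  proof -
    have "g x - Q x = (1/2) *\<^sub>R (g x - P x) - (1/2) *\<^sub>R (g (- x) - P (- x))"
      unfolding Q_def odd[OF that] by (simp add: algebra_simps flip: scaleR_add_left)
    then have "norm (g x - Q x) \<le> norm ((1/2) *\<^sub>R (g x - P x)) + norm ((1/2) *\<^sub>R (g (- x) - P (- x)))"
      by (metis norm_triangle_ineq4)
    also have "\<dots> < 1"
      using P(3)[OF that] P(3)[OF uminus_coord_sphere[OF that]] by simp
    finally show ?thesis .
  qed
  have g1: "norm (g x) = 1" if "x \<in> ?S" for x
    using g that by (auto simp: coord_sphere_def Pi_iff)
  have Q0: "Q x \<noteq> 0" if "x \<in> ?S" for x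
    using Qg[OF that] g1[OF that] by auto
  have diffP: "P differentiable_on X" for X
    using P(1) differentiable_on_polynomial_function by blast
  have diffP': "(\<lambda>x. P (- x)) differentiable_on X" for X
    by (rule differentiable_on_compose[OF _ diffP]) (auto intro: derivative_intros)
  have diffQ: "Q differentiable_on X" for X
    unfolding Q_def by (intro derivative_intros diffP diffP')
  have diffh: "h differentiable_on ?S"
    unfolding h_def using Q0
    by (fastforce intro: derivative_intros diffQ differentiable_on_compose [OF diffQ])
  have conth: "continuous_on ?S h"
    using differentiable_imp_continuous_on diffh by blast
  have hS: "h \<in> ?S \<rightarrow> ?S"
    using Q0 QV normalize_in_coord_sphere by (simp add: h_def)
  have sub: "coord_sphere (Suc d) \<subseteq> ?S"
    using coord_space_mono[of "Suc d" "Suc (Suc d)"] by (auto simp: coord_sphere_def)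
  have "h ` (sphere 0 1 \<inter> coord_space (Suc d)) \<noteq> sphere 0 1 \<inter> ?V"
  proof (rule spheremap_lemma1)
    show "dim (coord_space (Suc d)) < dim ?V"
      using d by (simp add: dim_coord_space)
    show "h differentiable_on sphere 0 1 \<inter> coord_space (Suc d)"
      using diffh sub differentiable_on_subset unfolding coord_sphere_def by blast
  qed (auto simp: subspace_coord_space coord_space_mono)
  then have "h ` coord_sphere (Suc d) \<noteq> ?S"
    by (simp add: coord_sphere_def)
  moreover have "h ` coord_sphere (Suc d) \<subseteq> ?S"
    using hS sub by blast
  ultimately obtain a where a: "a \<in> ?S" "a \<notin> h ` coord_sphere (Suc d)"
    by blast
  show thesis
  proof
    show "h (- x) = - h x" for x
      by (simp add: h_def Qodd)
    show "h x \<noteq> - g x" if "x \<in> ?S" for x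
    proof
      assume "h x = - g x"
      then have *: "Q x = - norm (Q x) *\<^sub>R g x"
        using Q0[OF that] unfolding h_def
        by (metis divideR_right norm_eq_zero scaleR_minus_left scaleR_minus_right)
      have "g x - Q x = (1 + norm (Q x)) *\<^sub>R g x"
        by (subst *) (simp add: algebra_simps)
      then have "norm (g x - Q x) = 1 + norm (Q x)"
        using g1[OF that] by simp
      with Qg[OF that] show False by simp
    qed
  qed (use conth hS a in blast)+
qed

text \<open>
  The reflection in the hyperplane orthogonal to \<open>a - b d\<close> exchanges the unit vectors \<open>a\<close> and \<open>b d\<close>.
\<close>

lemma reflection_to_axis:
  assumes d: "d < DIM('a)" and a: "a \<in> coord_sphere (Suc d)"
  obtains R where "linear R" "R \<in> coord_sphere (Suc d) \<rightarrow> coord_sphere (Suc d)"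
     "\<And>x. R (R x) = x" "R a = b d"
proof -
  define v where "v = a - b d"
  define R where "R = (\<lambda>y. y - (2 * (y \<bullet> v) / (v \<bullet> v)) *\<^sub>R v)"
  have lin: "linear R"
    unfolding R_def by (rule linearI) (simp_all add: algebra_simps add_divide_distrib)
  have bb: "b d \<bullet> b d = 1" using inner_b d by simp
  have aa: "a \<bullet> a = 1" using a by (simp add: coord_sphere_def norm_eq_1)
  have bV: "b d \<in> coord_space (Suc d)"
    using d by (auto simp: coord_space_def inner_b)
  have vV: "v \<in> coord_space (Suc d)"
    using a bV subspace_diff[OF subspace_coord_space] by (simp add: v_def coord_sphere_def)
  have inv: "R (R x) = x" for x
  proof (cases "v = 0")
    case False
    then have nz: "v \<bullet> v \<noteq> 0" by simp
    have "R x \<bullet> v = - (x \<bullet> v)"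
      using nz by (simp add: R_def algebra_simps inner_diff_left)
    then have "R (R x) = R x + (2 * (x \<bullet> v) / (v \<bullet> v)) *\<^sub>R v"
      by (subst R_def) simp
    then show ?thesis by (simp add: R_def)
  qed (simp add: R_def)
  have nR: "R x \<bullet> R x = x \<bullet> x" for x
  proof (cases "v = 0")
    case False
    then have nz: "v \<bullet> v \<noteq> 0" by simp
    define c where "c = 2 * (x \<bullet> v) / (v \<bullet> v)"
    have c: "c * (v \<bullet> v) = 2 * (x \<bullet> v)" using nz by (simp add: c_def)
    have "R x \<bullet> R x = x \<bullet> x - 2 * c * (x \<bullet> v) + c * (c * (v \<bullet> v))"
      using c by (simp add: R_def c_def[symmetric] algebra_simps inner_commute)
    then show ?thesis by (simp add: c)
  qed (simp add: R_def)
  have Ra: "R a = b d"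
  proof (cases "v = 0")
    case False
    then have nz: "v \<bullet> v \<noteq> 0" by simp
    have "v \<bullet> v = 2 * (a \<bullet> v)"
      unfolding v_def by (simp add: algebra_simps aa bb inner_commute)
    then have "R a = a - v" using nz by (simp add: R_def)
    then show ?thesis by (simp add: v_def)
  qed (simp add: R_def v_def)
  have "R x \<in> coord_sphere (Suc d)" if "x \<in> coord_sphere (Suc d)" for x
  proof -
    have "R x \<in> coord_space (Suc d)"
      unfolding R_def using that vV
      by (intro subspace_diff subspace_mul subspace_coord_space) (auto simp: coord_sphere_def)
    then show ?thesis
      using that nR[of x] by (simp add: coord_sphere_def norm_eq_sqrt_inner)
  qed
  then show thesis
    using that lin inv Ra by blast
qed

text \<open>
  Move each value \<open>g x\<close> along its meridian towards the equator by an amount that depends on the height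
  of \<open>x\<close>: all the way if \<open>x\<close> lies on the equator, and not at all if \<open>x\<close> is a pole. Since \<open>g\<close> is odd,
  it takes neither pole as a value on the equator if it omits one of them there, so the motion is
  defined. The height enters through its absolute value, which keeps the new map odd.
\<close>

lemma push_to_equator:
  assumes d: "Suc d < DIM('a)"
    and g: "continuous_on (coord_sphere (Suc (Suc d))) g"
      "g \<in> coord_sphere (Suc (Suc d)) \<rightarrow> coord_sphere (Suc (Suc d))"
    and odd: "\<And>x. x \<in> coord_sphere (Suc (Suc d)) \<Longrightarrow> g (- x) = - g x"
    and avoid: "b (Suc d) \<notin> g ` coord_sphere (Suc d)"
  obtains h where "continuous_on (coord_sphere (Suc (Suc d))) h"
      "h \<in> coord_sphere (Suc (Suc d)) \<rightarrow> coord_sphere (Suc (Suc d))"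
      "\<And>x. x \<in> coord_sphere (Suc (Suc d)) \<Longrightarrow> h (- x) = - h x"
      "\<And>x. x \<in> coord_sphere (Suc (Suc d)) \<Longrightarrow> h x \<noteq> - g x"
      "h \<in> coord_sphere (Suc d) \<rightarrow> coord_sphere (Suc d)"
proof -
  let ?S = "coord_sphere (Suc (Suc d))" and ?V = "coord_space (Suc (Suc d))"
  let ?e = "b (Suc d)"
  have ee: "?e \<bullet> ?e = 1" using inner_b d by simp
  have eV: "?e \<in> ?V"
    using d by (auto simp: coord_space_def inner_b)
  have sub: "coord_sphere (Suc d) \<subseteq> ?S"
    using coord_space_mono[of "Suc d" "Suc (Suc d)"] by (auto simp: coord_sphere_def)
  have equator: "x \<in> coord_sphere (Suc d)" if "x \<in> ?S" "x \<bullet> ?e = 0" for x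
    using that by (auto simp: coord_sphere_def coord_space_def) (metis not_less_eq_eq le_antisym)
  have equator0: "x \<bullet> ?e = 0" if "x \<in> coord_sphere (Suc d)" for x
    using that d by (auto simp: coord_sphere_def coord_space_def)
  define q where "q = (\<lambda>x. g x - ((1 - \<bar>x \<bullet> ?e\<bar>) * (g x \<bullet> ?e)) *\<^sub>R ?e)"
  define h where "h = (\<lambda>x. q x /\<^sub>R norm (q x))"
  have g1: "norm (g x) = 1" if "x \<in> ?S" for x
    using g that by (auto simp: coord_sphere_def Pi_iff)
  \<comment> \<open>At \<open>c = 0\<close> this makes \<open>q\<close> normalisable, and for \<open>c > 0\<close> it excludes antipodal values.\<close>
  have neq: "q x \<noteq> - c *\<^sub>R g x" if x: "x \<in> ?S" and c: "c \<ge> 0" for x c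
  proof
    assume eq: "q x = - c *\<^sub>R g x"
    have "q x \<bullet> ?e = - c * (g x \<bullet> ?e)" using eq by simp
    then have e2: "(\<bar>x \<bullet> ?e\<bar> + c) * (g x \<bullet> ?e) = 0"
      by (simp add: q_def inner_diff_left ee algebra_simps)
    show False
    proof (cases "g x \<bullet> ?e = 0")
      case True
      have "(1 + c) *\<^sub>R g x = g x - (- c *\<^sub>R g x)"
        by (simp add: algebra_simps)
      also have "\<dots> = 0"
        unfolding eq[symmetric] by (simp add: q_def True)
      finally have "(1 + c) *\<^sub>R g x = 0" .
      then show False using c g1[OF x] by auto
    next
      case False
      then have "x \<bullet> ?e = 0" "c = 0" using e2 c by (auto simp: add_nonneg_eq_0_iff)
      then have xe: "x \<in> coord_sphere (Suc d)" and gx: "g x = (g x \<bullet> ?e) *\<^sub>R ?e"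
        using equator[OF x] eq by (auto simp: q_def)
      have "norm (g x) = \<bar>g x \<bullet> ?e\<bar> * norm ?e"
        using gx by (metis norm_scaleR)
      then have "\<bar>g x \<bullet> ?e\<bar> = 1"
        using g1[OF x] ee by (simp add: norm_eq_sqrt_inner)
      then have "g x = ?e \<or> g x = - ?e"
        using gx by (metis abs_eq_iff abs_1 scaleR_one scaleR_minus1_left)
      then have "g x = ?e \<or> g (- x) = ?e"
        using odd[OF x] by auto
      then show False
        using avoid xe uminus_coord_sphere[OF xe] by (metis imageI)
    qed
  qed
  have q0: "q x \<noteq> 0" if "x \<in> ?S" for x
    using neq[OF that, of 0] by simp
  have qV: "q x \<in> ?V" if "x \<in> ?S" for x
    unfolding q_def using g(2) that eV
    by (intro subspace_diff subspace_mul subspace_coord_space) (auto simp: coord_sphere_def Pi_iff)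
  have hS: "h x \<in> ?S" if "x \<in> ?S" for x
    unfolding h_def using q0[OF that] qV[OF that] by (rule normalize_in_coord_sphere[rotated])
  show thesis
  proof
    have "continuous_on ?S q"
      unfolding q_def by (intro continuous_intros g)
    then show "continuous_on ?S h"
      unfolding h_def using q0 by (intro continuous_intros) auto
    show "h \<in> ?S \<rightarrow> ?S" using hS by blast
    show "h (- x) = - h x" if "x \<in> ?S" for x
    proof -
      have "q (- x) = - q x"
        unfolding q_def odd[OF that] by (simp add: algebra_simps)
      then show ?thesis by (simp add: h_def)
    qed
    show "h x \<noteq> - g x" if "x \<in> ?S" for x
    proof
      assume "h x = - g x"
      then have "q x = - norm (q x) *\<^sub>R g x"
        using q0[OF that] unfolding h_def
        by (metis divideR_right norm_eq_zero scaleR_minus_left scaleR_minus_right)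
      then show False using neq[OF that, of "norm (q x)"] by simp
    qed
    have "q x \<bullet> ?e = 0" if "x \<in> coord_sphere (Suc d)" for x
      by (simp add: q_def equator0[OF that] inner_diff_left ee)
    then show "h \<in> coord_sphere (Suc d) \<rightarrow> coord_sphere (Suc d)"
      using hS equator sub by (auto simp: h_def)
  qed
qed

text \<open>
  In the induction step \<open>h\<close> has the degree of \<open>g\<close>, the reflection \<open>R\<close> multiplies it by an odd number,
  and \<open>k\<close> has the degree of \<open>R \<circ> h\<close> but also preserves the equator, where the induction hypothesis
  applies.
\<close>

theorem Borsuk_odd_map_odd_degree:
  assumes "d < DIM('a)"
    and "continuous_on (coord_sphere (Suc d)) g"
      "g \<in> coord_sphere (Suc d) \<rightarrow> coord_sphere (Suc d)"
    and "\<And>x. x \<in> coord_sphere (Suc d) \<Longrightarrow> g (- x) = - g x"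
  shows "odd (sphere_degree d g)"
  using assms
proof (induction d arbitrary: g)
  case 0
  have *: "x = b 0 \<or> x = - b 0" if x: "x \<in> coord_sphere (Suc 0)" for x
  proof -
    have "vec_of (coords x) = (\<Sum>i\<in>{0}. coords x i *\<^sub>R b i)"
      unfolding vec_of_def using x
      by (intro sum.mono_neutral_right) (auto simp: coord_sphere_def coord_space_def coords_def)
    then have xc: "x = coords x 0 *\<^sub>R b 0" by simp
    have "norm x = \<bar>coords x 0\<bar> * norm (b 0)"
      by (subst xc) simp
    then have "\<bar>coords x 0\<bar> = 1"
      using x 0 b_in_Basis[of 0] by (simp add: coord_sphere_def)
    then show ?thesis
      using xc by (metis abs_eq_iff abs_1 scaleR_one scaleR_minus1_left)
  qed
  have "b 0 \<in> coord_sphere (Suc 0)"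
    using b_in_Basis[of 0] by (auto simp: coord_sphere_def coord_space_def inner_b)
  then have "g (b 0) = b 0 \<or> g (b 0) = - b 0" "g (- b 0) = - g (b 0)"
    using * 0 by (auto simp: Pi_iff)
  then have "g (g x) = x" if "x \<in> coord_sphere (Suc 0)" for x
    using *[OF that] by auto
  then show ?case
    using odd_degree_involution 0 by blast
next
  case (Suc d)
  let ?S = "coord_sphere (Suc (Suc d))"
  note d = \<open>Suc d < DIM('a)\<close>
  obtain h a where h: "continuous_on ?S h" "h \<in> ?S \<rightarrow> ?S"
      "\<And>x. x \<in> ?S \<Longrightarrow> h (- x) = - h x" "\<And>x. x \<in> ?S \<Longrightarrow> h x \<noteq> - g x"
    and a: "a \<in> ?S" "a \<notin> h ` coord_sphere (Suc d)"
    using odd_approximation_omitting_axis[OF d Suc.prems(2-4)] by blast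
  obtain R where R: "linear R" "R \<in> ?S \<rightarrow> ?S" "\<And>x. R (R x) = x" "R a = b (Suc d)"
    using reflection_to_axis[OF d a(1)] by blast
  have contR: "continuous_on X R" for X
    using R(1) linear_continuous_on linear_conv_bounded_linear by blast
  have Rh: "continuous_on ?S (R \<circ> h)" "R \<circ> h \<in> ?S \<rightarrow> ?S"
      "\<And>x. x \<in> ?S \<Longrightarrow> (R \<circ> h) (- x) = - (R \<circ> h) x"
    using continuous_on_compose[OF h(1) contR] h R by (auto simp: Pi_iff linear_neg)
  have "b (Suc d) \<notin> (R \<circ> h) ` coord_sphere (Suc d)"
  proof
    assume "b (Suc d) \<in> (R \<circ> h) ` coord_sphere (Suc d)"
    then obtain x where x: "x \<in> coord_sphere (Suc d)" "R a = R (h x)"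
      using R(4) by auto
    then have "a = h x" using R(3) by metis
    then show False using a(2) x(1) by blast
  qed
  then obtain k where k: "continuous_on ?S k" "k \<in> ?S \<rightarrow> ?S"
      "\<And>x. x \<in> ?S \<Longrightarrow> k (- x) = - k x" "\<And>x. x \<in> ?S \<Longrightarrow> k x \<noteq> - (R \<circ> h) x"
      "k \<in> coord_sphere (Suc d) \<rightarrow> coord_sphere (Suc d)"
    using push_to_equator[OF d Rh] by blast
  have sub: "coord_sphere (Suc d) \<subseteq> ?S"
    using coord_space_mono[of "Suc d" "Suc (Suc d)"] by (auto simp: coord_sphere_def)
  have "odd (sphere_degree d k)"
  proof (rule Suc.IH)
    show "d < DIM('a)" using d by simp
    show "continuous_on (coord_sphere (Suc d)) k"
      using k(1) sub continuous_on_subset by blast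
  qed (use k sub in auto)
  moreover have "even (sphere_degree (Suc d) k - sphere_degree d k)"
    by (rule even_degree_diff_equator[OF d k(1,2) k(3) k(5)])
  ultimately have "odd (sphere_degree (Suc d) k)"
    by simp
  also have "sphere_degree (Suc d) k = sphere_degree (Suc d) (R \<circ> h)"
    by (rule sphere_degree_cong_nonantipodal[OF d Rh(1,2) k(1,2) k(4), symmetric])
  also have "\<dots> = sphere_degree (Suc d) R * sphere_degree (Suc d) h"
    by (rule sphere_degree_compose[OF d h(1,2) contR R(2)])
  finally have "odd (sphere_degree (Suc d) h)"
    by simp
  then show ?case
    using sphere_degree_cong_nonantipodal[OF d Suc.prems(2,3) h(1,2,4)] by simp
qed

text \<open>
  Borsuk-Ulam: after normalisation, a nonvanishing odd map into fewer coordinates would be an odd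
  self-map of the sphere that is not onto, with degree \<open>0\<close>, which is even.
\<close>

theorem no_odd_nonvanishing_map:
  assumes md: "m \<le> d" and d: "d < DIM('a)"
    and h: "continuous_map (top_of_set (coord_sphere (Suc d))) (Euclidean_space m) h"
    and odd: "\<And>x i. x \<in> coord_sphere (Suc d) \<Longrightarrow> h (- x) i = - h x i"
  shows "\<exists>x\<in>coord_sphere (Suc d). h x = (\<lambda>i. 0)"
proof (rule ccontr)
  let ?S = "coord_sphere (Suc d)"
  assume "\<not> ?thesis"
  then have h0: "h x \<noteq> (\<lambda>i. 0)" if "x \<in> ?S" for x
    using that by blast
  have hm: "h x i = 0" if "x \<in> ?S" "m \<le> i" for x i
    using continuous_map_image_subset_topspace[OF h] that
    by (auto simp: topspace_Euclidean_space)
  define q where "q = (\<lambda>x. vec_of (h x))"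
  define g where "g = (\<lambda>x. q x /\<^sub>R norm (q x))"
  have coords_q: "coords (q x) = h x" if "x \<in> ?S" for x
    unfolding q_def by (rule coords_vec_of) (use hm that md d in auto)
  have q0: "q x \<noteq> 0" if "x \<in> ?S" for x
  proof
    assume "q x = 0"
    then have "coords (q x) = (\<lambda>i. 0)"
      by (simp add: coords_def fun_eq_iff)
    then show False
      using coords_q[OF that] h0[OF that] by simp
  qed
  have qV: "q x \<in> coord_space m" if "x \<in> ?S" for x
    using hm[OF that] by (auto simp: coord_space_def q_def inner_vec_of)
  have cont_comp: "continuous_on ?S (\<lambda>x. h x i)" for i
  proof -
    have "continuous_map (top_of_set ?S) (powertop_real UNIV) h"
      using h by (simp add: Euclidean_space_def continuous_map_in_subtopology)
    then show ?thesis
      by (simp add: continuous_map_componentwise_UNIV)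
  qed
  have "continuous_on ?S q"
    unfolding q_def vec_of_def by (intro continuous_intros cont_comp)
  then have g: "continuous_on ?S g"
    unfolding g_def using q0 by (intro continuous_intros) auto
  have gm: "g x \<in> coord_sphere m" if "x \<in> ?S" for x
    unfolding g_def using q0[OF that] qV[OF that] by (rule normalize_in_coord_sphere[rotated])
  have sub: "coord_sphere m \<subseteq> ?S"
    using coord_space_mono[of m "Suc d"] md by (auto simp: coord_sphere_def)
  have gS: "g \<in> ?S \<rightarrow> ?S" using gm sub by blast
  have "odd (sphere_degree d g)"
  proof (rule Borsuk_odd_map_odd_degree[OF d g gS])
    fix x assume x: "x \<in> ?S"
    have "h (- x) = (\<lambda>i. - h x i)" using odd[OF x] by auto
    then show "g (- x) = - g x"
      by (simp add: g_def q_def vec_of_uminus)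
  qed
  moreover have "sphere_degree d g = 0"
    unfolding sphere_degree_def
  proof (rule Brouwer_degree2_nonsurjective)
    show "continuous_map (nsphere d) (nsphere d) (coords \<circ> g \<circ> vec_of)"
      by (rule continuous_map_conj[OF d g gS])
    have "b d \<in> ?S"
      using b_in_Basis[OF d] d by (auto simp: coord_sphere_def coord_space_def inner_b)
    then have "coords (b d) \<in> topspace (nsphere d)"
      using coord_sphere_iff d by blast
    moreover have "coords (b d) \<notin> (coords \<circ> g \<circ> vec_of) ` topspace (nsphere d)"
    proof
      assume "coords (b d) \<in> (coords \<circ> g \<circ> vec_of) ` topspace (nsphere d)"
      then obtain c where c: "c \<in> topspace (nsphere d)" "coords (b d) = coords (g (vec_of c))"
        by auto
      then have "b d = g (vec_of c)" by (metis vec_of_coords)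
      then have "b d \<in> coord_space m"
        using gm vec_of_in_coord_sphere[OF d c(1)] by (simp add: coord_sphere_def)
      then have "b d \<bullet> b d = 0" using md d by (simp add: coord_space_def)
      then show False using d by (simp add: inner_b)
    qed
    ultimately show "(coords \<circ> g \<circ> vec_of) ` topspace (nsphere d) \<noteq> topspace (nsphere d)"
      by blast
  qed
  ultimately show False by simp
qed

text \<open>
  An odd map from \<open>X\<close> to $\mathbb{R}^m \setminus \{0\}$ can be composed with \<open>e\<close>, so that Borsuk-Ulam
  applies to the sphere of dimension \<open>k-1\<close>.
\<close>

lemma genus_ge_of_odd_map:
  fixes X :: "'b::real_normed_vector set"
  assumes k: "1 \<le> k" "k \<le> DIM('a)"
    and e: "continuous_on (coord_sphere k) e" "e \<in> coord_sphere k \<rightarrow> X"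
    and odd: "\<And>x. x \<in> coord_sphere k \<Longrightarrow> e (- x) = - e x"
    and X: "X \<noteq> {}"
  shows "enat k \<le> genus X"
proof -
  have "k \<le> m" if hm: "has_odd_map X m" for m
  proof (rule ccontr)
    assume "\<not> k \<le> m"
    obtain d where d: "k = Suc d" using k by (cases k) auto
    then have md: "m \<le> d" "d < DIM('a)" using k \<open>\<not> k \<le> m\<close> by auto
    obtain h where h: "continuous_map (top_of_set X) (Euclidean_space m) h"
      and hodd: "\<forall>x\<in>X. \<forall>i. h (- x) i = - h x i" and h0: "\<forall>x\<in>X. h x \<noteq> (\<lambda>i. 0)"
      using hm unfolding has_odd_map_def by auto
    have "continuous_map (top_of_set (coord_sphere k)) (top_of_set X) e"
      using e by auto
    then have "continuous_map (top_of_set (coord_sphere (Suc d))) (Euclidean_space m) (h \<circ> e)"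
      using h d continuous_map_compose by blast
    moreover have "(h \<circ> e) (- x) i = - (h \<circ> e) x i" if "x \<in> coord_sphere (Suc d)" for x i
      using that e(2) hodd odd d by (auto simp: Pi_iff)
    ultimately obtain x where "x \<in> coord_sphere (Suc d)" "(h \<circ> e) x = (\<lambda>i. 0)"
      using no_odd_nonvanishing_map[OF md] by blast
    then show False using h0 e(2) d by (auto simp: Pi_iff)
  qed
  then show ?thesis
    using X by (auto simp: genus_def intro!: Inf_greatest)
qed

end

section \<open>Power inequalities\<close>

lemma powr_convex_comb:
  fixes a b t p :: real
  assumes "0 \<le> a" "0 \<le> b" "0 \<le> t" "t \<le> 1" "p \<ge> 1"
  shows "((1 - t) * a + t * b) powr p \<le> (1 - t) * a powr p + t * b powr p"
proof -
  have scale: "(s * c) powr p \<le> s * c powr p" if "0 \<le> s" "s \<le> 1" "0 \<le> c" for s c :: real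
  proof -
    have "s powr p \<le> s"
      using that assms(5) powr_mono'[of 1 p s] by (cases "s = 0") auto
    then show ?thesis
      using that by (simp add: powr_mult mult_right_mono)
  qed
  show ?thesis
  proof (cases "a = 0 \<or> b = 0")
    case True
    then show ?thesis
      using scale[of t b] scale[of "1 - t" a] assms by auto
  next
    case False
    then have "a \<in> {0<..}" "b \<in> {0<..}" using assms by auto
    then show ?thesis
      using convex_onD[OF powr_convex[OF assms(5)], of t a b] assms by simp
  qed
qed

lemma abs_diff_powr_le:
  fixes a b p :: real
  assumes "p \<ge> 1"
  shows "\<bar>a - b\<bar> powr p \<le> 2 powr (p - 1) * (\<bar>a\<bar> powr p + \<bar>b\<bar> powr p)"
proof -
  have "\<bar>a - b\<bar> powr p \<le> (\<bar>a\<bar> + \<bar>b\<bar>) powr p"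
    using assms by (intro powr_mono2) auto
  also have "\<bar>a\<bar> + \<bar>b\<bar> = 2 * ((1 - 1/2) * \<bar>a\<bar> + 1/2 * \<bar>b\<bar>)"
    by simp
  also have "\<dots> powr p = 2 powr p * ((1 - 1/2) * \<bar>a\<bar> + 1/2 * \<bar>b\<bar>) powr p"
    by (rule powr_mult)
  also have "\<dots> \<le> 2 powr p * ((1 - 1/2) * \<bar>a\<bar> powr p + 1/2 * \<bar>b\<bar> powr p)"
    using assms by (intro mult_left_mono powr_convex_comb) auto
  also have "\<dots> = 2 powr (p - 1) * (\<bar>a\<bar> powr p + \<bar>b\<bar> powr p)"
    by (simp add: powr_diff field_simps)
  finally show ?thesis .
qed

text \<open>
  Young's inequality with conjugate exponents \<open>p\<close> and \<open>p/(p-1)\<close>, applied to $s^{1/p}d$ and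
  $s^{-1/p}x^{p-1}$.
\<close>

lemma Young_weighted:
  fixes x d s p :: real
  assumes "p > 1" "s > 0" "x \<ge> 0" "d \<ge> 0"
  shows "p * x powr (p - 1) * d \<le> s * d powr p + (p - 1) * s powr (- 1 / (p - 1)) * x powr p"
proof -
  define q where "q = p / (p - 1)"
  have q: "q > 1" "1 / p + 1 / q = 1" "(p - 1) * q = p" "p / q = p - 1"
    using assms by (auto simp: q_def field_simps)
  have "(s powr (1/p) * d) * (s powr (- 1/p) * x powr (p - 1))
      \<le> (s powr (1/p) * d) powr p / p + (s powr (- 1/p) * x powr (p - 1)) powr q / q"
    using assms q by (intro Youngs_inequality) auto
  also have "(s powr (1/p) * d) * (s powr (- 1/p) * x powr (p - 1)) = x powr (p - 1) * d"
    using assms by (simp add: powr_minus field_simps)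
  also have "(s powr (1/p) * d) powr p = s * d powr p"
    using assms by (simp add: powr_mult powr_powr)
  also have "(s powr (- 1/p) * x powr (p - 1)) powr q = s powr (- 1 / (p - 1)) * x powr p"
    using assms q(3) by (simp add: powr_mult powr_powr) (simp add: q_def)
  finally have "p * (x powr (p - 1) * d)
      \<le> p * (s * d powr p / p + s powr (- 1 / (p - 1)) * x powr p / q)"
    using assms by (intro mult_left_mono) auto
  also have "\<dots> = s * d powr p + (p / q) * (s powr (- 1 / (p - 1)) * x powr p)"
    using assms by (simp add: field_simps)
  finally show ?thesis
    by (simp add: q(4) mult.assoc)
qed

text \<open>
  For $a<b$ and $d=b-a$ this comes from integrating over $x \in [a,b]$ the weighted Young inequality
  $p x^{p-1} d \le s d^p + C x^p$ with $C=(p-1)s^{-1/(p-1)}$ and replacing $x^p$ on the right by its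
  chord, which lies above it by convexity; the mean value of the chord is $(a^p+b^p)/2$. The proof compares the two
  antiderivatives by the mean value theorem instead of integrating.
\<close>

lemma powr_diff_bound:
  fixes a b s p :: real
  assumes p: "p > 1" and s: "s > 0" and ab: "0 \<le> a" "0 \<le> b"
  shows "\<bar>a powr p - b powr p\<bar>
     \<le> s * \<bar>a - b\<bar> powr p + (p - 1) * s powr (- 1 / (p - 1)) * ((a powr p + b powr p) / 2)"
proof -
  have main: "b powr p - a powr p
     \<le> s * (b - a) powr p + (p - 1) * s powr (- 1 / (p - 1)) * ((a powr p + b powr p) / 2)"
    if a: "0 \<le> a" and ab: "a < b" for a b :: real
  proof -
    define d where "d = b - a"
    have d: "d > 0" using ab by (simp add: d_def)
    define C where "C = (p - 1) * s powr (- 1 / (p - 1))"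
    have C: "C \<ge> 0" using p by (simp add: C_def)
    define S where "S = s * d powr p"
    define Pa where "Pa = a powr p"
    define Pb where "Pb = b powr p"
    define F where "F = (\<lambda>x. S * ((x - a) / d)
      + C * (Pa * ((x - a) / d) + (Pb - Pa) * ((x - a) / d)\<^sup>2 / 2) - x powr p)"
    define F' where "F' = (\<lambda>x. (S + C * (Pa + (Pb - Pa) * ((x - a) / d)) - p * x powr (p - 1) * d) / d)"
    have der: "(F has_real_derivative F' x) (at x)" if "x > 0" for x
      unfolding F_def F'_def using that d
      by (auto intro!: derivative_eq_intros simp: field_simps power2_eq_square)
    have "continuous_on {a..b} F"
    proof -
      have "continuous_on {a..b} (\<lambda>x. x powr p)"
        using a p by (intro continuous_on_powr') auto
      then show ?thesis
        unfolding F_def using d by (intro continuous_on_diff[of _ _ "\<lambda>x. x powr p"]) (auto intro!: continuous_intros)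
    qed
    moreover have "F differentiable (at x)" if "a < x" "x < b" for x
      using der[of x] that a real_differentiable_def by force
    ultimately obtain l z where z: "a < z" "z < b" "DERIV F z :> l" "F b - F a = (b - a) * l"
      using MVT[OF ab] by blast
    have l: "l = F' z"
      using DERIV_unique[OF z(3) der] z(1) a by simp
    define t where "t = (z - a) / d"
    have t: "0 \<le> t" "t \<le> 1"
      using z d by (auto simp: t_def d_def)
    have zt: "z = (1 - t) * a + t * b"
    proof -
      have "t * d = z - a" using d by (simp add: t_def)
      then show ?thesis by (simp add: d_def algebra_simps)
    qed
    have "z powr p \<le> (1 - t) * a powr p + t * b powr p"
      unfolding zt using a ab t p by (intro powr_convex_comb) auto
    then have "C * z powr p \<le> C * (a powr p + (b powr p - a powr p) * t)"
      using C by (intro mult_left_mono) (auto simp: algebra_simps)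
    moreover have "p * z powr (p - 1) * d \<le> s * d powr p + C * z powr p"
      unfolding C_def using p s z a d by (intro Young_weighted) auto
    ultimately have "l \<ge> 0"
      unfolding l F'_def t_def S_def Pa_def Pb_def using d by simp
    then have "F a \<le> F b"
      using z(4) ab by (smt (verit) mult_nonneg_nonneg)
    moreover have "(b - a) / d = 1"
      using d by (simp add: d_def)
    then have "F b = S + C * (Pa + (Pb - Pa) / 2) - Pb"
      unfolding F_def Pb_def by simp
    moreover have "F a = - Pa"
      by (simp add: F_def Pa_def)
    moreover have "C * (Pa + (Pb - Pa) / 2) = C * ((Pa + Pb) / 2)"
      by (simp add: field_simps)
    ultimately have "Pb - Pa \<le> S + C * ((Pa + Pb) / 2)"
      by linarith
    then show ?thesis
      by (simp add: S_def Pa_def Pb_def C_def d_def)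
  qed
  show ?thesis
  proof (cases a b rule: linorder_cases)
    case less
    then have "a powr p \<le> b powr p" using ab p by (intro powr_mono2) auto
    then show ?thesis using main[OF ab(1) less] less by simp
  next
    case equal
    then show ?thesis using p by simp
  next
    case greater
    then have "b powr p \<le> a powr p" using ab p by (intro powr_mono2) auto
    then show ?thesis using main[OF ab(2) greater] greater by (simp add: add.commute)
  qed
qed

text \<open>
  For $l>0$ the best weight is $s=(t/(2l))^{(p-1)/p}$, which makes the two terms equal up to the factor
  \<open>p-1\<close> and gives $H \le p\,l^{1/p}(t/2)^{(p-1)/p}$. For $l=0$ large \<open>s\<close> forces $H=0$. If
  $t=0$, the left-hand side of the conclusion is \<open>0\<close> by division by zero.
\<close>

lemma optimized_weight_bound:
  fixes H l t p :: real
  assumes p: "p > 1" and H: "H \<ge> 0" and l: "l \<ge> 0" and t: "t \<ge> 0"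
    and bound: "\<And>s. s > 0 \<Longrightarrow> H \<le> s * l + (p - 1) * s powr (- 1 / (p - 1)) * (t / 2)"
  shows "2 powr (p - 1) / t powr (p - 1) * (H powr p / p powr p) \<le> l"
proof (cases "t = 0 \<or> H = 0")
  case True
  then show ?thesis using l p by auto
next
  case False
  then have t0: "t > 0" and H0: "H > 0" using H t by auto
  show ?thesis
  proof (cases "l = 0")
    case True
    \<comment> \<open>With this weight the hypothesis reads \<open>H \<le> H / 2\<close>.\<close>
    define s where "s = (H / ((p - 1) * t)) powr (- (p - 1))"
    have "s powr (- 1 / (p - 1)) = H / ((p - 1) * t)"
    proof -
      have "- (p - 1) * (- 1 / (p - 1)) = 1" using p by (simp add: field_simps)
      then show ?thesis
        unfolding s_def powr_powr using p t0 H0 by simp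
    qed
    moreover have "s > 0" using p t0 H0 by (simp add: s_def)
    ultimately have "H \<le> (p - 1) * (H / ((p - 1) * t)) * (t / 2)"
      using bound[of s] True by simp
    also have "\<dots> = H / 2" using p t0 by (simp add: field_simps)
    finally show ?thesis using H0 by simp
  next
    case False
    then have l0: "l > 0" using l by simp
    define r where "r = t / 2"
    have r: "r > 0" using t0 by (simp add: r_def)
    define s where "s = (r / l) powr ((p - 1) / p)"
    have s: "s > 0" using r l0 by (simp add: s_def)
    define K where "K = l powr (1 / p) * r powr ((p - 1) / p)"
    have pp: "(p - 1) / p = 1 - 1 / p" using p by (simp add: field_simps)
    have "s * l = K"
      using r l0 by (simp add: s_def K_def powr_divide pp powr_diff field_simps)
    moreover have "s powr (- 1 / (p - 1)) = (r / l) powr (- (1 / p))"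
      unfolding s_def powr_powr using p by (simp add: field_simps)
    moreover have "(r / l) powr (- (1 / p)) * r = K"
      using r l0 by (simp add: K_def powr_divide powr_minus pp powr_diff field_simps)
    ultimately have "H \<le> K + (p - 1) * K"
      using bound[OF s] unfolding r_def[symmetric] by (simp add: mult.assoc)
    then have "H \<le> p * K" by (simp add: algebra_simps)
    then have "H powr p \<le> (p * K) powr p"
      using H p by (intro powr_mono2) auto
    also have "\<dots> = p powr p * (l * r powr (p - 1))"
      using p l0 r by (simp add: K_def powr_mult powr_powr)
    finally have "H powr p / p powr p \<le> l * r powr (p - 1)"
      using p by (simp add: field_simps)
    then have "(H powr p / p powr p) / r powr (p - 1) \<le> l"
      by (subst pos_divide_le_eq) (use r in auto)
    moreover have "2 powr (p - 1) / t powr (p - 1) = 1 / r powr (p - 1)"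
      using t0 by (simp add: r_def powr_divide)
    ultimately show ?thesis
      by (simp add: mult.commute)
  qed
qed

section \<open>Co-area inequality\<close>

lemma sum_sum_boundary:
  fixes w :: "'v::finite \<Rightarrow> 'v \<Rightarrow> real"
  assumes sym: "\<And>u v. w u v = w v u"
  shows "(\<Sum>u\<in>UNIV. \<Sum>v\<in>UNIV. w u v * \<bar>indicator S u - indicator S v\<bar>)
    = 2 * (\<Sum>u\<in>S. \<Sum>v\<in>- S. w u v)"
proof -
  have "(\<Sum>u\<in>UNIV. \<Sum>v\<in>UNIV. w u v * \<bar>indicator S u - indicator S v\<bar>)
     = (\<Sum>u\<in>UNIV. \<Sum>v\<in>UNIV. indicator S u * (indicator (- S) v * w u v) + indicator S v * (indicator (- S) u * w v u))"
    by (intro sum.cong refl) (auto simp: indicator_def sym)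
  also have "\<dots> = 2 * (\<Sum>u\<in>UNIV. \<Sum>v\<in>UNIV. indicator S u * (indicator (- S) v * w u v))"
  proof -
    have "(\<Sum>u\<in>UNIV. \<Sum>v\<in>UNIV. indicator S v * (indicator (- S) u * w v u))
        = (\<Sum>u\<in>UNIV. \<Sum>v\<in>UNIV. indicator S u * (indicator (- S) v * w u v))"
      by (rule sum.swap)
    then show ?thesis
      unfolding sum.distrib by (simp only: mult_2)
  qed
  also have "(\<Sum>u\<in>UNIV. \<Sum>v\<in>UNIV. indicator S u * (indicator (- S) v * w u v))
     = (\<Sum>u\<in>S. \<Sum>v\<in>- S. w u v)"
  proof -
    have "(\<Sum>v\<in>UNIV. indicator (- S) v * w u v) = (\<Sum>v\<in>- S. w u v)" for u
      by (rule sum.mono_neutral_cong_right) auto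
    moreover have "(\<Sum>u\<in>UNIV. indicator S u * (\<Sum>v\<in>- S. w u v)) = (\<Sum>u\<in>S. \<Sum>v\<in>- S. w u v)"
      by (rule sum.mono_neutral_cong_right) auto
    ultimately show ?thesis
      by (simp only: flip: sum_distrib_left)
  qed
  finally show ?thesis .
qed

text \<open>
  A discrete co-area inequality. Subtracting from \<open>g\<close> its smallest positive value \<open>c\<close> on the support
  \<open>S\<close> splits off exactly \<open>c\<close> times the indicator of \<open>S\<close>, on both sides of the inequality; the
  remainder has smaller support.
\<close>

lemma coarea_inequality:
  fixes w :: "'v::finite \<Rightarrow> 'v \<Rightarrow> real" and \<mu> g :: "'v \<Rightarrow> real"
  assumes sym: "\<And>u v. w u v = w v u"
    and g: "\<And>u. g u \<ge> 0" "\<And>u. u \<notin> A \<Longrightarrow> g u = 0"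
    and h: "\<And>B. B \<noteq> {} \<Longrightarrow> B \<subseteq> A \<Longrightarrow> h * (\<Sum>u\<in>B. \<mu> u) \<le> (\<Sum>u\<in>B. \<Sum>v\<in>- B. w u v)"
  shows "h * (\<Sum>u\<in>UNIV. \<mu> u * g u) \<le> 1/2 * (\<Sum>u\<in>UNIV. \<Sum>v\<in>UNIV. w u v * \<bar>g u - g v\<bar>)"
  using g
proof (induction "card {u. g u > 0}" arbitrary: g rule: less_induct)
  case less
  define S where "S = {u. g u > 0}"
  have gS: "g u = 0" if "u \<notin> S" for u
    using less.prems(1)[of u] that by (simp add: S_def)
  show ?case
  proof (cases "S = {}")
    case True
    then have "g = (\<lambda>u. 0)" using gS by auto
    then show ?thesis by simp
  next
    case False
    define c where "c = Min (g ` S)"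
    have c: "c \<in> g ` S" "\<And>u. u \<in> S \<Longrightarrow> c \<le> g u"
      using False by (auto simp: c_def)
    then have c0: "c > 0" by (auto simp: S_def)
    define k where "k = (\<lambda>u. g u - c * indicator S u)"
    have k: "k u \<ge> 0" "u \<notin> A \<Longrightarrow> k u = 0" for u
      using c(2)[of u] less.prems(1)[of u] less.prems(2)[of u] c0
      by (cases "u \<in> S"; force simp: k_def S_def)+
    have "{u. k u > 0} \<subset> S"
    proof
      show "{u. k u > 0} \<subseteq> S"
      proof
        fix u assume "u \<in> {u. k u > 0}"
        then show "u \<in> S" using gS[of u] by (cases "u \<in> S") (auto simp: k_def)
      qed
      obtain u where "u \<in> S" "g u = c" using c(1) by auto
      then have "u \<in> S" "k u = 0" by (auto simp: k_def)
      then show "{u. k u > 0} \<noteq> S" by force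
    qed
    then have "card {u. k u > 0} < card {u. g u > 0}"
      by (simp add: S_def psubset_card_mono)
    then have IH: "h * (\<Sum>u\<in>UNIV. \<mu> u * k u) \<le> 1/2 * (\<Sum>u\<in>UNIV. \<Sum>v\<in>UNIV. w u v * \<bar>k u - k v\<bar>)"
      using less.hyps k by blast
    have "S \<subseteq> A" using less.prems(2) by (force simp: S_def)
    then have cut: "h * (\<Sum>u\<in>S. \<mu> u) \<le> (\<Sum>u\<in>S. \<Sum>v\<in>- S. w u v)"
      using h False by blast
    have split: "\<bar>g u - g v\<bar> = \<bar>k u - k v\<bar> + c * \<bar>indicator S u - indicator S v\<bar>" for u v
      using c(2)[of u] c(2)[of v] gS[of u] gS[of v] c0
      by (cases "u \<in> S"; cases "v \<in> S") (simp_all add: k_def)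
    have "(\<Sum>u\<in>UNIV. \<Sum>v\<in>UNIV. w u v * \<bar>g u - g v\<bar>)
      = (\<Sum>u\<in>UNIV. \<Sum>v\<in>UNIV. w u v * \<bar>k u - k v\<bar>)
        + c * (\<Sum>u\<in>UNIV. \<Sum>v\<in>UNIV. w u v * \<bar>indicator S u - indicator S v\<bar>)"
      unfolding split by (simp add: sum.distrib sum_distrib_left algebra_simps)
    also have "\<dots> = (\<Sum>u\<in>UNIV. \<Sum>v\<in>UNIV. w u v * \<bar>k u - k v\<bar>) + c * (2 * (\<Sum>u\<in>S. \<Sum>v\<in>- S. w u v))"
      by (simp only: sum_sum_boundary[of w, OF sym])
    finally have e1: "1/2 * (\<Sum>u\<in>UNIV. \<Sum>v\<in>UNIV. w u v * \<bar>g u - g v\<bar>)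
      = 1/2 * (\<Sum>u\<in>UNIV. \<Sum>v\<in>UNIV. w u v * \<bar>k u - k v\<bar>) + c * (\<Sum>u\<in>S. \<Sum>v\<in>- S. w u v)"
      by simp
    have "(\<Sum>u\<in>UNIV. \<mu> u * g u) = (\<Sum>u\<in>UNIV. \<mu> u * k u + c * (\<mu> u * indicator S u))"
      by (intro sum.cong) (auto simp: k_def algebra_simps)
    also have "\<dots> = (\<Sum>u\<in>UNIV. \<mu> u * k u) + c * (\<Sum>u\<in>S. \<mu> u)"
      by (simp add: sum.distrib flip: sum_distrib_left)
    finally have e2: "h * (\<Sum>u\<in>UNIV. \<mu> u * g u) = h * (\<Sum>u\<in>UNIV. \<mu> u * k u) + c * (h * (\<Sum>u\<in>S. \<mu> u))"
      by (simp add: algebra_simps)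
    show ?thesis
      unfolding e1 e2 using IH cut c0 by (intro add_mono mult_left_mono) auto
  qed
qed

section \<open>Basic estimates on weighted graphs\<close>

context connected_weighted_graph
begin

lemma edge_weight_nonneg: "w u v \<ge> 0"
  using edge_weight_pos[of u v] edge_weight_zero[of u v] by (cases "{u, v} \<in> E") auto

lemma measure_pos: "B \<noteq> {} \<Longrightarrow> (\<Sum>u\<in>B. \<mu> u) > 0"
  by (intro sum_pos vertex_weight_pos) auto

lemma p_norm_pos:
  assumes "g x \<noteq> 0"
  shows "(\<Sum>u\<in>UNIV. \<mu> u * \<bar>g u\<bar> powr p) > 0"
proof (rule sum_pos2[of _ x])
  show "\<mu> x * \<bar>g x\<bar> powr p > 0" using assms vertex_weight_pos[of x] by simp
  show "0 \<le> \<mu> i * \<bar>g i\<bar> powr p" for i using vertex_weight_pos[of i] by simp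
qed auto

lemma cut_ratio_nonneg: "cut_ratio \<mu> w B \<ge> 0"
  unfolding cut_ratio_def
  by (intro divide_nonneg_nonneg sum_nonneg edge_weight_nonneg less_imp_le[OF vertex_weight_pos])

lemma vertex_degree_le: "vertex_degree w u \<le> max_degree_ratio \<mu> w * \<mu> u"
proof -
  have "vertex_degree w u / \<mu> u \<le> max_degree_ratio \<mu> w"
    unfolding max_degree_ratio_def by (intro Max_ge) auto
  then show ?thesis
    using vertex_weight_pos[of u] by (simp add: field_simps)
qed

lemma max_degree_ratio_nonneg: "max_degree_ratio \<mu> w \<ge> 0"
proof -
  fix u :: 'v
  have "0 \<le> vertex_degree w u"
    unfolding vertex_degree_def by (intro sum_nonneg edge_weight_nonneg)
  also have "\<dots> \<le> max_degree_ratio \<mu> w * \<mu> u" by (rule vertex_degree_le)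
  finally show ?thesis
    using vertex_weight_pos[of u] by (simp add: zero_le_mult_iff)
qed

lemma isoperimetric_constant_le:
  assumes "\<A> \<in> disjoint_families k"
  shows "isoperimetric_constant \<mu> w k \<le> Max (cut_ratio \<mu> w ` \<A>)"
  unfolding isoperimetric_constant_def using assms by (intro Min_le) auto

lemma isoperimetric_constant_attained:
  assumes "disjoint_families k \<noteq> ({} :: 'v set set set)"
  obtains \<A> where "\<A> \<in> disjoint_families k" "isoperimetric_constant \<mu> w k = Max (cut_ratio \<mu> w ` \<A>)"
proof -
  have "isoperimetric_constant \<mu> w k \<in> (\<lambda>\<A>. Max (cut_ratio \<mu> w ` \<A>)) ` disjoint_families k"
    unfolding isoperimetric_constant_def using assms by (intro Min_in) auto
  then show thesis using that by auto
qed

lemma isoperimetric_constant_nonneg: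
  assumes "disjoint_families k \<noteq> ({} :: 'v set set set)" "k \<ge> 1"
  shows "isoperimetric_constant \<mu> w k \<ge> 0"
proof -
  obtain \<A> where A: "\<A> \<in> disjoint_families k" "isoperimetric_constant \<mu> w k = Max (cut_ratio \<mu> w ` \<A>)"
    using isoperimetric_constant_attained[OF assms(1)] by blast
  then obtain B where B: "B \<in> \<A>" using assms(2) by (fastforce simp: disjoint_families_def)
  have "0 \<le> cut_ratio \<mu> w B" by (rule cut_ratio_nonneg)
  also have "\<dots> \<le> Max (cut_ratio \<mu> w ` \<A>)" using B by (intro Max_ge) auto
  finally show ?thesis using A by simp
qed

section \<open>Superlevel cuts of a non-negative function\<close>

text \<open>
  A set \<open>B\<close> minimising the cut ratio among the nonempty subsets of \<open>A\<close> satisfies the bound for all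
  \<open>s\<close> at once, so the optimal \<open>s\<close> may be chosen later, when the bounds for all nodal domains have been
  combined.
\<close>

lemma Cheeger_sweep:
  assumes p: "p > 1"
    and g: "\<And>u. g u \<ge> 0" "\<And>u. u \<notin> A \<Longrightarrow> g u = 0" "g \<noteq> (\<lambda>u. 0)"
    and energy: "1/2 * (\<Sum>u\<in>UNIV. \<Sum>v\<in>UNIV. w u v * \<bar>g u - g v\<bar> powr p)
       \<le> l * (\<Sum>u\<in>UNIV. \<mu> u * g u powr p)"
  obtains B where "B \<noteq> {}" "B \<subseteq> A"
    "\<And>s. s > 0 \<Longrightarrow> cut_ratio \<mu> w B \<le> s * l + (p - 1) * s powr (- 1 / (p - 1)) * (max_degree_ratio \<mu> w / 2)"
proof -
  let ?M = "\<Sum>u\<in>UNIV. \<mu> u * g u powr p"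
  obtain x where x: "g x \<noteq> 0" using g(3) by auto
  then have "A \<noteq> {}" using g(2) by auto
  then have fin: "finite (Pow A - {{}})" "Pow A - {{}} \<noteq> {}" by auto
  then obtain B where B: "B \<in> Pow A - {{}}"
      and Bmin: "\<And>C. C \<in> Pow A - {{}} \<Longrightarrow> cut_ratio \<mu> w B \<le> cut_ratio \<mu> w C"
    by (metis (no_types, lifting) arg_min_if_finite(1) arg_min_least)
  have M: "?M > 0"
    using p_norm_pos[of g x p] x g(1) by simp
  have coarea: "cut_ratio \<mu> w B * ?M \<le> 1/2 * (\<Sum>u\<in>UNIV. \<Sum>v\<in>UNIV. w u v * \<bar>g u powr p - g v powr p\<bar>)"
  proof (rule coarea_inequality[where A = A])
    show "w u v = w v u" for u v by (rule edge_weight_sym)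
    show "u \<notin> A \<Longrightarrow> g u powr p = 0" for u using g(2) by simp
    fix C assume C: "C \<noteq> {}" "C \<subseteq> A"
    then have "cut_ratio \<mu> w B \<le> cut_ratio \<mu> w C" using Bmin by auto
    then show "cut_ratio \<mu> w B * (\<Sum>u\<in>C. \<mu> u) \<le> (\<Sum>u\<in>C. \<Sum>v\<in>- C. w u v)"
      using measure_pos[OF C(1)] by (simp add: cut_ratio_def[of _ _ C] pos_le_divide_eq)
  qed auto
  have "cut_ratio \<mu> w B \<le> s * l + (p - 1) * s powr (- 1 / (p - 1)) * (max_degree_ratio \<mu> w / 2)"
    if s: "s > 0" for s
  proof -
    define C where "C = (p - 1) * s powr (- 1 / (p - 1))"
    have C: "C \<ge> 0" using p by (simp add: C_def)
    let ?T = "max_degree_ratio \<mu> w"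
    have "(\<Sum>u\<in>UNIV. \<Sum>v\<in>UNIV. w u v * \<bar>g u powr p - g v powr p\<bar>)
      \<le> (\<Sum>u\<in>UNIV. \<Sum>v\<in>UNIV. w u v * (s * \<bar>g u - g v\<bar> powr p + C * ((g u powr p + g v powr p) / 2)))"
      unfolding C_def by (intro sum_mono mult_left_mono powr_diff_bound p s g edge_weight_nonneg)
    also have "\<dots> = s * (\<Sum>u\<in>UNIV. \<Sum>v\<in>UNIV. w u v * \<bar>g u - g v\<bar> powr p)
        + C / 2 * ((\<Sum>u\<in>UNIV. \<Sum>v\<in>UNIV. w u v * g u powr p) + (\<Sum>u\<in>UNIV. \<Sum>v\<in>UNIV. w u v * g v powr p))"
      by (simp add: sum.distrib sum_distrib_left algebra_simps add_divide_distrib)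
    also have "(\<Sum>u\<in>UNIV. \<Sum>v\<in>UNIV. w u v * g v powr p) = (\<Sum>u\<in>UNIV. \<Sum>v\<in>UNIV. w u v * g u powr p)"
      by (subst sum.swap) (simp add: edge_weight_sym)
    finally have 1: "1/2 * (\<Sum>u\<in>UNIV. \<Sum>v\<in>UNIV. w u v * \<bar>g u powr p - g v powr p\<bar>)
      \<le> s * (1/2 * (\<Sum>u\<in>UNIV. \<Sum>v\<in>UNIV. w u v * \<bar>g u - g v\<bar> powr p))
        + C / 2 * (\<Sum>u\<in>UNIV. \<Sum>v\<in>UNIV. w u v * g u powr p)"
      by (simp add: field_simps)
    have "(\<Sum>u\<in>UNIV. \<Sum>v\<in>UNIV. w u v * g u powr p) = (\<Sum>u\<in>UNIV. vertex_degree w u * g u powr p)"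
      by (simp add: vertex_degree_def sum_distrib_right)
    also have "\<dots> \<le> (\<Sum>u\<in>UNIV. ?T * \<mu> u * g u powr p)"
      by (intro sum_mono mult_right_mono vertex_degree_le) auto
    also have "\<dots> = ?T * ?M" by (simp add: sum_distrib_left mult.assoc)
    finally have "C / 2 * (\<Sum>u\<in>UNIV. \<Sum>v\<in>UNIV. w u v * g u powr p) \<le> C / 2 * (?T * ?M)"
      using C by (intro mult_left_mono) auto
    moreover have "s * (1/2 * (\<Sum>u\<in>UNIV. \<Sum>v\<in>UNIV. w u v * \<bar>g u - g v\<bar> powr p)) \<le> s * (l * ?M)"
      using s energy by (intro mult_left_mono) auto
    ultimately have "cut_ratio \<mu> w B * ?M \<le> (s * l + C * (?T / 2)) * ?M"
      using 1 coarea by (simp add: algebra_simps)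
    then show ?thesis
      using M unfolding C_def by (simp only: mult_le_cancel_right_pos)
  qed
  then show thesis
    using that B by auto
qed

section \<open>Nodal domains of eigenfunctions\<close>

lemma induces_connected_Un:
  assumes A: "induces_connected E A" and B: "induces_connected E B" and x: "x \<in> A" "x \<in> B"
  shows "induces_connected E (A \<union> B)"
proof -
  let ?r = "\<lambda>A. {(x, y). x \<in> A \<and> y \<in> A \<and> {x, y} \<in> E}"
  have mono: "(?r A)\<^sup>* \<subseteq> (?r (A \<union> B))\<^sup>*" "(?r B)\<^sup>* \<subseteq> (?r (A \<union> B))\<^sup>*"
    by (rule rtrancl_mono; auto)+
  have "(y, x) \<in> (?r (A \<union> B))\<^sup>* \<and> (x, y) \<in> (?r (A \<union> B))\<^sup>*" if "y \<in> A \<union> B" for y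
    using that A B x mono unfolding induces_connected_def by (meson UnE subsetD)
  then have "(u, v) \<in> (?r (A \<union> B))\<^sup>*" if "u \<in> A \<union> B" "v \<in> A \<union> B" for u v
    using that by (meson rtrancl_trans)
  then show ?thesis
    using x unfolding induces_connected_def by blast
qed

lemma components_disjoint:
  assumes "is_component_of E S A" "is_component_of E S B" "A \<noteq> B"
  shows "A \<inter> B = {}"
proof (rule ccontr)
  assume "A \<inter> B \<noteq> {}"
  then obtain x where "x \<in> A" "x \<in> B" by auto
  then have "induces_connected E (A \<union> B)"
    using assms induces_connected_Un by (auto simp: is_component_of_def)
  moreover have "A \<union> B \<subseteq> S" using assms by (auto simp: is_component_of_def)
  ultimately have "A \<union> B = A" "A \<union> B = B"
    using assms by (auto simp: is_component_of_def)
  with assms show False by auto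
qed

lemma no_edge_leaves_component:
  assumes A: "is_component_of E S A" and uv: "u \<in> A" "v \<in> S" "v \<notin> A"
  shows "w u v = 0"
proof (rule edge_weight_zero, rule notI)
  assume e: "{u, v} \<in> E"
  let ?r = "{(x, y). x \<in> {u, v} \<and> y \<in> {u, v} \<and> {x, y} \<in> E}"
  have "(u, v) \<in> ?r" "(v, u) \<in> ?r"
    using e by (auto simp: insert_commute)
  then have "induces_connected E {u, v}"
    unfolding induces_connected_def by (auto intro: r_into_rtrancl)
  then have "induces_connected E (A \<union> {u, v})"
    using induces_connected_Un[of A "{u, v}" u] A uv by (auto simp: is_component_of_def)
  then have "A \<union> {u, v} = A"
    using A uv unfolding is_component_of_def by (metis Un_upper1 Un_least insert_subset empty_subsetI subsetD)
  then show False using uv by auto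
qed

lemma component_exists:
  assumes "u \<in> S"
  obtains A where "is_component_of E S A"
proof -
  let ?F = "{B. B \<subseteq> S \<and> induces_connected E B}"
  have "{u} \<in> ?F" using assms by (auto simp: induces_connected_def)
  then obtain A where "A \<in> ?F" "\<forall>B\<in>?F. A \<subseteq> B \<longrightarrow> A = B"
    using finite_has_maximal2[of ?F "{u}"] by auto
  then have "is_component_of E S A" by (auto simp: is_component_of_def)
  then show thesis by (rule that)
qed

lemma Phi_mult_self: "Phi p x * x = \<bar>x\<bar> powr p"
proof (cases "x = 0")
  case False
  then have "\<bar>x\<bar> powr p = \<bar>x\<bar> powr (p - 2) * \<bar>x\<bar> powr 2"
    using powr_add[of "\<bar>x\<bar>" "p - 2" 2] by simp
  moreover have "\<bar>x\<bar> powr 2 = x * x"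
    using False by (simp add: powr_numeral power2_eq_square)
  ultimately show ?thesis
    by (simp add: Phi_def mult.assoc)
qed (simp add: Phi_def)

lemma Phi_uminus: "Phi p (- x) = - Phi p x"
  by (simp add: Phi_def)

text \<open>
  Summation by parts: the edge terms are antisymmetric in the two endpoints, because \<open>Phi\<close> is odd.
\<close>

lemma p_Laplacian_by_parts:
  "(\<Sum>u\<in>UNIV. p_Laplacian w p f $ u * g u)
     = 1/2 * (\<Sum>u\<in>UNIV. \<Sum>v\<in>UNIV. w u v * Phi p (f $ u - f $ v) * (g u - g v))"
proof -
  let ?P = "\<lambda>u v. w u v * Phi p (f $ u - f $ v)"
  have anti: "?P v u = - ?P u v" for u v
    using Phi_uminus[of p "f $ u - f $ v"] by (simp add: edge_weight_sym[of v u])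
  have "(\<Sum>u\<in>UNIV. \<Sum>v\<in>UNIV. ?P u v * g v) = (\<Sum>u\<in>UNIV. \<Sum>v\<in>UNIV. ?P v u * g u)"
    by (rule sum.swap)
  also have "\<dots> = - (\<Sum>u\<in>UNIV. \<Sum>v\<in>UNIV. ?P u v * g u)"
  proof -
    have "?P v u * g u = - (?P u v * g u)" for u v
      by (simp only: anti[where u = u and v = v] mult_minus_left)
    then show ?thesis by (simp only: sum_negf)
  qed
  finally show ?thesis
    by (simp add: p_Laplacian_def sum_distrib_right right_diff_distrib sum_subtractf)
qed

lemma eigenvalue_nonneg:
  assumes f: "is_eigenfunction \<mu> w p l f"
  shows "l \<ge> 0"
proof -
  have "0 \<le> 1/2 * (\<Sum>u\<in>UNIV. \<Sum>v\<in>UNIV. w u v * \<bar>f $ u - f $ v\<bar> powr p)"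
    by (intro mult_nonneg_nonneg sum_nonneg edge_weight_nonneg) auto
  also have "\<dots> = (\<Sum>u\<in>UNIV. p_Laplacian w p f $ u * f $ u)"
    unfolding p_Laplacian_by_parts by (simp add: Phi_mult_self mult.assoc)
  also have "\<dots> = (\<Sum>u\<in>UNIV. l * \<mu> u * (Phi p (f $ u) * f $ u))"
    using f by (simp add: is_eigenfunction_def mult.assoc)
  also have "\<dots> = l * (\<Sum>u\<in>UNIV. \<mu> u * \<bar>f $ u\<bar> powr p)"
    by (simp add: Phi_mult_self sum_distrib_left mult.assoc)
  finally have *: "0 \<le> l * (\<Sum>u\<in>UNIV. \<mu> u * \<bar>f $ u\<bar> powr p)" .
  obtain x where x: "f $ x \<noteq> 0"
    using f by (auto simp: is_eigenfunction_def vec_eq_iff)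
  then have "(\<Sum>u\<in>UNIV. \<mu> u * \<bar>f $ u\<bar> powr p) > 0"
    by (rule p_norm_pos)
  with * show ?thesis by (simp add: zero_le_mult_iff)
qed

text \<open>
  Summation by parts against \<open>g\<close> turns the right-hand side into a sum over edges, which is compared
  with the energy term by term. Inside \<open>A\<close> the two agree. Across the boundary of \<open>A\<close> an edge of
  positive weight joins \<open>f u > 0\<close> to \<open>f v \<le> 0\<close>, so that \<open>f u - f v \<ge> f u\<close>.
\<close>

lemma energy_on_component:
  assumes p: "p > 1" and f: "is_eigenfunction \<mu> w p l f"
    and A: "is_component_of E {u. f $ u > 0} A"
  defines "g \<equiv> \<lambda>u. if u \<in> A then f $ u else 0"
  shows "1/2 * (\<Sum>u\<in>UNIV. \<Sum>v\<in>UNIV. w u v * \<bar>g u - g v\<bar> powr p)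
       \<le> l * (\<Sum>u\<in>UNIV. \<mu> u * g u powr p)"
proof -
  have fA: "f $ u > 0" if "u \<in> A" for u
    using A that by (auto simp: is_component_of_def)
  have cross: "w u v * x powr p \<le> w u v * (Phi p (x - f $ v) * x)"
    if u: "u \<in> A" and v: "v \<notin> A" and x: "x = f $ u" for u v x
  proof (cases "f $ v > 0")
    case True
    then show ?thesis using no_edge_leaves_component[OF A u] v by simp
  next
    case False
    have x0: "x > 0" using fA u x by simp
    have "x powr (p - 1) \<le> (x - f $ v) powr (p - 1)"
      using False p x0 by (intro powr_mono2) auto
    also have "\<dots> = Phi p (x - f $ v)"
      using False x0 powr_mult_base[of "x - f $ v" "p - 2"]
      by (simp add: Phi_def mult.commute)
    finally have "x powr (p - 1) * x \<le> Phi p (x - f $ v) * x"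
      using x0 by (intro mult_right_mono) auto
    moreover have "x powr (p - 1) * x = x powr p"
      using x0 powr_mult_base[of x "p - 1"] by (simp add: mult.commute)
    ultimately show ?thesis
      by (intro mult_left_mono edge_weight_nonneg) simp
  qed
  have pointwise: "w u v * \<bar>g u - g v\<bar> powr p \<le> w u v * Phi p (f $ u - f $ v) * (g u - g v)" for u v
  proof (cases "u \<in> A"; cases "v \<in> A")
    assume "u \<in> A" "v \<in> A"
    then show ?thesis by (simp add: g_def Phi_mult_self mult.assoc)
  next
    assume "u \<in> A" "v \<notin> A"
    then show ?thesis using cross[of u v] fA[of u] by (simp add: g_def mult.assoc)
  next
    assume uv: "u \<notin> A" "v \<in> A"
    have "Phi p (f $ u - f $ v) = - Phi p (f $ v - f $ u)"
      using Phi_uminus[of p "f $ v - f $ u"] by simp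
    then show ?thesis using uv cross[of v u] fA[of v]
      by (simp add: g_def mult.assoc edge_weight_sym[of v u])
  qed (simp add: g_def)
  have "1/2 * (\<Sum>u\<in>UNIV. \<Sum>v\<in>UNIV. w u v * \<bar>g u - g v\<bar> powr p)
     \<le> 1/2 * (\<Sum>u\<in>UNIV. \<Sum>v\<in>UNIV. w u v * Phi p (f $ u - f $ v) * (g u - g v))"
    by (intro mult_left_mono sum_mono pointwise) auto
  also have "\<dots> = (\<Sum>u\<in>UNIV. p_Laplacian w p f $ u * g u)"
    by (rule p_Laplacian_by_parts[symmetric])
  also have "\<dots> = (\<Sum>u\<in>UNIV. l * (\<mu> u * g u powr p))"
  proof (rule sum.cong[OF refl])
    fix u
    have "Phi p (f $ u) * g u = g u powr p"
      using Phi_mult_self[of p "f $ u"] fA[of u] by (cases "u \<in> A") (simp_all add: g_def)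
    then show "p_Laplacian w p f $ u * g u = l * (\<mu> u * g u powr p)"
      using f by (simp add: is_eigenfunction_def mult.assoc)
  qed
  finally show ?thesis by (simp add: sum_distrib_left)
qed

lemma is_eigenfunction_uminus:
  assumes "is_eigenfunction \<mu> w p l f"
  shows "is_eigenfunction \<mu> w p l (- f)"
proof -
  have "Phi p ((- f) $ u - (- f) $ v) = - Phi p (f $ u - f $ v)" for u v
    using Phi_uminus[of p "f $ u - f $ v"] by simp
  then have "p_Laplacian w p (- f) $ u = - p_Laplacian w p f $ u" for u
    by (simp only: p_Laplacian_def vec_lambda_beta mult_minus_right sum_negf)
  then show ?thesis
    using assms by (simp add: is_eigenfunction_def Phi_uminus)
qed

text \<open>
  Negative nodal domains are reduced to positive ones by passing from \<open>f\<close> to \<open>- f\<close>.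
\<close>

lemma nodal_domain_sweep:
  assumes p: "p > 1" and f: "is_eigenfunction \<mu> w p l f" and A: "A \<in> strong_nodal_domains E f"
  shows "\<exists>B. B \<noteq> {} \<and> B \<subseteq> A \<and> (\<forall>s>0. cut_ratio \<mu> w B
     \<le> s * l + (p - 1) * s powr (- 1 / (p - 1)) * (max_degree_ratio \<mu> w / 2))"
proof -
  have *: ?thesis if f: "is_eigenfunction \<mu> w p l f" and A: "is_component_of E {u. f $ u > 0} A" for f
  proof -
    define g where "g = (\<lambda>u. if u \<in> A then f $ u else 0)"
    have fA: "f $ u > 0" if "u \<in> A" for u
      using A that by (auto simp: is_component_of_def)
    obtain x where "x \<in> A"
      using A by (auto simp: is_component_of_def induces_connected_def)
    then have "g x \<noteq> 0" using fA[of x] by (simp add: g_def)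
    then have g: "\<And>u. g u \<ge> 0" "\<And>u. u \<notin> A \<Longrightarrow> g u = 0" "g \<noteq> (\<lambda>u. 0)"
      using fA less_imp_le by (auto simp: g_def dest: fun_cong[of _ _ x])
    have energy: "1/2 * (\<Sum>u\<in>UNIV. \<Sum>v\<in>UNIV. w u v * \<bar>g u - g v\<bar> powr p)
        \<le> l * (\<Sum>u\<in>UNIV. \<mu> u * g u powr p)"
      unfolding g_def by (rule energy_on_component[OF p f A])
    show ?thesis
      by (rule Cheeger_sweep[OF p g energy]) blast+
  qed
  have "{u. f $ u < 0} = {u. (- f) $ u > 0}" by simp
  then show ?thesis
    using A *[OF f] *[OF is_eigenfunction_uminus[OF f]] unfolding strong_nodal_domains_def by auto
qed

lemma disjoint_strong_nodal_domains:
  assumes "A \<in> strong_nodal_domains E f" "B \<in> strong_nodal_domains E f" "A \<noteq> B"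
  shows "A \<inter> B = {}"
proof -
  have "A \<subseteq> {u. f $ u > 0}" if "is_component_of E {u. f $ u > 0} A" for A
    using that by (simp add: is_component_of_def)
  moreover have "A \<subseteq> {u. f $ u < 0}" if "is_component_of E {u. f $ u < 0} A" for A
    using that by (simp add: is_component_of_def)
  moreover have "{u. f $ u > 0} \<inter> {u. f $ u < 0} = {}" by auto
  ultimately show ?thesis
    using assms components_disjoint unfolding strong_nodal_domains_def by blast
qed

lemma strong_nodal_domains_nonempty:
  assumes "f \<noteq> 0"
  shows "strong_nodal_domains E f \<noteq> {}"
proof -
  obtain x where "f $ x \<noteq> 0" using assms by (auto simp: vec_eq_iff)
  then have "x \<in> {u. f $ u > 0} \<or> x \<in> {u. f $ u < 0}" by auto
  then obtain A where "is_component_of E {u. f $ u > 0} A \<or> is_component_of E {u. f $ u < 0} A"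
    using component_exists by metis
  then show ?thesis by (auto simp: strong_nodal_domains_def)
qed

text \<open>
  The chosen subsets of the nodal domains form an admissible family for \<open>h_m\<close>, so the bound for the
  worst of them bounds \<open>h_m\<close>, for every \<open>s\<close>.
\<close>

theorem Cheeger_lower_bound:
  assumes p: "p > 1" and f: "is_eigenfunction \<mu> w p l f"
    and m: "m = card (strong_nodal_domains E f)"
  shows "2 powr (p - 1) / max_degree_ratio \<mu> w powr (p - 1)
           * (isoperimetric_constant \<mu> w m powr p / p powr p) \<le> l"
proof -
  let ?N = "strong_nodal_domains E f"
  obtain B where B: "\<And>A. A \<in> ?N \<Longrightarrow> B A \<noteq> {}" "\<And>A. A \<in> ?N \<Longrightarrow> B A \<subseteq> A"
    and Bs: "\<And>A s. A \<in> ?N \<Longrightarrow> s > 0 \<Longrightarrow> cut_ratio \<mu> w (B A)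
     \<le> s * l + (p - 1) * s powr (- 1 / (p - 1)) * (max_degree_ratio \<mu> w / 2)"
    using nodal_domain_sweep[OF p f] by metis
  have disj: "B A \<inter> B A' = {}" if "A \<in> ?N" "A' \<in> ?N" "A \<noteq> A'" for A A'
    using disjoint_strong_nodal_domains[OF that] B(2) that by blast
  have "inj_on B ?N"
    using disj B(1) by (metis inf.idem inj_onI)
  then have "card (B ` ?N) = m" by (simp add: card_image m)
  moreover have "disjoint (B ` ?N)"
    using disj by (force simp: disjoint_def)
  ultimately have fam: "B ` ?N \<in> disjoint_families m"
    using B(1) by (auto simp: disjoint_families_def)
  have N: "?N \<noteq> {}"
    using f strong_nodal_domains_nonempty by (simp add: is_eigenfunction_def)
  then have m1: "m \<ge> 1" by (simp add: m card_gt_0_iff Suc_le_eq)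
  have "Max (cut_ratio \<mu> w ` B ` ?N) \<in> cut_ratio \<mu> w ` B ` ?N"
    using N by (intro Max_in) auto
  then obtain A where A: "A \<in> ?N" "Max (cut_ratio \<mu> w ` B ` ?N) = cut_ratio \<mu> w (B A)"
    by auto
  show ?thesis
  proof (rule optimized_weight_bound[OF p _ eigenvalue_nonneg[OF f] max_degree_ratio_nonneg])
    show "0 \<le> isoperimetric_constant \<mu> w m"
      using fam m1 by (intro isoperimetric_constant_nonneg) auto
    show "isoperimetric_constant \<mu> w m
       \<le> s * l + (p - 1) * s powr (- 1 / (p - 1)) * (max_degree_ratio \<mu> w / 2)" if "s > 0" for s
      using isoperimetric_constant_le[OF fam] A Bs[OF A(1) that] by simp
  qed
qed

end

section \<open>Block-constant functions and the upper bound\<close>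

definition block_constant :: "'v set set \<Rightarrow> (real ^ 'v) set" where
  "block_constant \<A> = {g. (\<forall>B\<in>\<A>. \<forall>u\<in>B. \<forall>v\<in>B. g $ u = g $ v) \<and> (\<forall>u. u \<notin> \<Union>\<A> \<longrightarrow> g $ u = 0)}"

lemma block_constantI:
  assumes "\<And>B u v. B \<in> \<A> \<Longrightarrow> u \<in> B \<Longrightarrow> v \<in> B \<Longrightarrow> g $ u = g $ v"
    and "\<And>u. u \<notin> \<Union>\<A> \<Longrightarrow> g $ u = 0"
  shows "g \<in> block_constant \<A>"
  unfolding block_constant_def using assms by blast

lemma block_constant_eq:
  "g \<in> block_constant \<A> \<Longrightarrow> B \<in> \<A> \<Longrightarrow> u \<in> B \<Longrightarrow> v \<in> B \<Longrightarrow> g $ u = g $ v"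
  unfolding block_constant_def by blast

lemma block_constant_outside:
  "g \<in> block_constant \<A> \<Longrightarrow> u \<notin> \<Union>\<A> \<Longrightarrow> g $ u = 0"
  unfolding block_constant_def by blast

lemma p_norm_continuous:
  fixes \<mu> :: "'v::finite \<Rightarrow> real"
  assumes "p > 0"
  shows "continuous_on X (\<lambda>g::real^'v. \<Sum>u\<in>UNIV. \<mu> u * \<bar>g $ u\<bar> powr p)"
proof -
  have "continuous_on X (\<lambda>g::real^'v. \<bar>g $ u\<bar> powr p)" for u
    using assms by (intro continuous_on_powr') (auto intro!: continuous_intros)
  then show ?thesis
    by (intro continuous_on_sum continuous_on_mult continuous_on_const)
qed

lemma closed_p_sphere:
  fixes \<mu> :: "'v::finite \<Rightarrow> real"
  assumes "p > 0"
  shows "closed (p_sphere \<mu> p)"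
proof -
  show ?thesis
    unfolding p_sphere_def
    by (intro closed_Collect_eq p_norm_continuous assms continuous_on_const)
qed

lemma subspace_block_constant: "subspace (block_constant \<A> :: (real ^ 'v::finite) set)"
  unfolding subspace_def
proof (intro conjI ballI allI)
  show "(0 :: real ^ 'v) \<in> block_constant \<A>"
    by (rule block_constantI) simp_all
next
  fix g h :: "real ^ 'v"
  assume g: "g \<in> block_constant \<A>" and h: "h \<in> block_constant \<A>"
  show "g + h \<in> block_constant \<A>"
  proof (rule block_constantI)
    show "(g + h) $ u = (g + h) $ v" if "B \<in> \<A>" "u \<in> B" "v \<in> B" for B u v
      using block_constant_eq[OF g that] block_constant_eq[OF h that] by simp
    show "(g + h) $ u = 0" if "u \<notin> \<Union>\<A>" for u
      using block_constant_outside[OF g that] block_constant_outside[OF h that] by simp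
  qed
next
  fix c :: real and g :: "real ^ 'v"
  assume g: "g \<in> block_constant \<A>"
  show "c *\<^sub>R g \<in> block_constant \<A>"
  proof (rule block_constantI)
    show "(c *\<^sub>R g) $ u = (c *\<^sub>R g) $ v" if "B \<in> \<A>" "u \<in> B" "v \<in> B" for B u v
      using block_constant_eq[OF g that] by simp
    show "(c *\<^sub>R g) $ u = 0" if "u \<notin> \<Union>\<A>" for u
      using block_constant_outside[OF g that] by simp
  qed
qed

context connected_weighted_graph
begin

text \<open>
  Only pairs not contained in a common block contribute to the energy. Such a pair is charged to each
  endpoint separately by $|a-b|^p \le 2^{p-1}(|a|^p+|b|^p)$, and the charges of a block add up to the
  weight of its boundary times the common value of $|g|^p$.
\<close>

lemma block_constant_energy_le:
  assumes p: "p > 1" and disj: "disjoint \<A>" and ne: "{} \<notin> \<A>"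
    and H: "\<And>B. B \<in> \<A> \<Longrightarrow> cut_ratio \<mu> w B \<le> H"
    and g: "g \<in> block_constant \<A>"
  shows "1/2 * (\<Sum>u\<in>UNIV. \<Sum>v\<in>UNIV. w u v * \<bar>g $ u - g $ v\<bar> powr p)
     \<le> 2 powr (p - 1) * (H * (\<Sum>u\<in>UNIV. \<mu> u * \<bar>g $ u\<bar> powr p))"
proof -
  define same where "same = (\<lambda>u v. \<exists>B\<in>\<A>. u \<in> B \<and> v \<in> B)"
  define X where "X = (\<lambda>u v. if same u v then 0 else w u v * \<bar>g $ u\<bar> powr p)"
  have X_nonneg: "X u v \<ge> 0" for u v
    by (simp add: X_def edge_weight_nonneg)
  have same_eq: "g $ u = g $ v" if "same u v" for u v
    using block_constant_eq[OF g] that unfolding same_def by blast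
  have same_sym: "same u v \<longleftrightarrow> same v u" for u v
    by (auto simp: same_def)
  have pointwise: "w u v * \<bar>g $ u - g $ v\<bar> powr p \<le> 2 powr (p - 1) * (X u v + X v u)" for u v
  proof (cases "same u v")
    case True
    then show ?thesis using same_eq[OF True] X_nonneg by simp
  next
    case False
    have "w u v * \<bar>g $ u - g $ v\<bar> powr p
       \<le> w u v * (2 powr (p - 1) * (\<bar>g $ u\<bar> powr p + \<bar>g $ v\<bar> powr p))"
      using p by (intro mult_left_mono abs_diff_powr_le edge_weight_nonneg) auto
    then show ?thesis
      using False same_sym[of u v] by (simp add: X_def edge_weight_sym[of v u] algebra_simps)
  qed
  have block: "(\<Sum>u\<in>B. \<Sum>v\<in>UNIV. X u v) \<le> H * (\<Sum>u\<in>B. \<mu> u * \<bar>g $ u\<bar> powr p)" if B: "B \<in> \<A>" for B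
  proof -
    obtain y where y: "y \<in> B" using ne B by (metis ex_in_conv)
    have gy: "g $ u = g $ y" if "u \<in> B" for u
      by (rule block_constant_eq[OF g B that y])
    have same_B: "same u v \<longleftrightarrow> v \<in> B" if "u \<in> B" for u v
      using B that disj unfolding same_def disjoint_def by blast
    have "(\<Sum>v\<in>UNIV. X u v) = \<bar>g $ y\<bar> powr p * (\<Sum>v\<in>- B. w u v)" if u: "u \<in> B" for u
    proof -
      have "(\<Sum>v\<in>UNIV. X u v) = (\<Sum>v\<in>- B. w u v * \<bar>g $ y\<bar> powr p)"
        by (rule sum.mono_neutral_cong_right) (auto simp: X_def same_B[OF u] gy[OF u])
      then show ?thesis by (simp add: mult.commute flip: sum_distrib_left sum_distrib_right)
    qed
    then have "(\<Sum>u\<in>B. \<Sum>v\<in>UNIV. X u v) = \<bar>g $ y\<bar> powr p * (\<Sum>u\<in>B. \<Sum>v\<in>- B. w u v)"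
      by (simp add: sum_distrib_left)
    also have "\<dots> \<le> \<bar>g $ y\<bar> powr p * (H * (\<Sum>u\<in>B. \<mu> u))"
    proof (rule mult_left_mono)
      have "(\<Sum>u\<in>B. \<mu> u) > 0" using measure_pos y by blast
      then show "(\<Sum>u\<in>B. \<Sum>v\<in>- B. w u v) \<le> H * (\<Sum>u\<in>B. \<mu> u)"
        using H[OF B] by (simp add: cut_ratio_def pos_divide_le_eq)
    qed simp
    also have "\<dots> = H * (\<Sum>u\<in>B. \<mu> u * \<bar>g $ u\<bar> powr p)"
      by (simp add: gy sum_distrib_left mult_ac)
    finally show ?thesis .
  qed
  have disj': "\<forall>A\<in>\<A>. \<forall>B\<in>\<A>. A \<noteq> B \<longrightarrow> A \<inter> B = {}"
    using disj by (auto simp: disjoint_def)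
  have outside: "g $ u = 0" if "u \<notin> \<Union>\<A>" for u
    by (rule block_constant_outside[OF g that])
  have "1/2 * (\<Sum>u\<in>UNIV. \<Sum>v\<in>UNIV. w u v * \<bar>g $ u - g $ v\<bar> powr p)
     \<le> 1/2 * (\<Sum>u\<in>UNIV. \<Sum>v\<in>UNIV. 2 powr (p - 1) * (X u v + X v u))"
    by (intro mult_left_mono sum_mono pointwise) auto
  also have "\<dots> = 2 powr (p - 1) * (1/2 * ((\<Sum>u\<in>UNIV. \<Sum>v\<in>UNIV. X u v) + (\<Sum>u\<in>UNIV. \<Sum>v\<in>UNIV. X v u)))"
    by (simp add: sum.distrib flip: sum_distrib_left)
  also have "(\<Sum>u\<in>UNIV. \<Sum>v\<in>UNIV. X v u) = (\<Sum>u\<in>UNIV. \<Sum>v\<in>UNIV. X u v)"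
    by (rule sum.swap)
  also have "1/2 * ((\<Sum>u\<in>UNIV. \<Sum>v\<in>UNIV. X u v) + (\<Sum>u\<in>UNIV. \<Sum>v\<in>UNIV. X u v)) = (\<Sum>u\<in>UNIV. \<Sum>v\<in>UNIV. X u v)"
    by simp
  also have "(\<Sum>u\<in>UNIV. \<Sum>v\<in>UNIV. X u v) = (\<Sum>u\<in>\<Union>\<A>. \<Sum>v\<in>UNIV. X u v)"
  proof (rule sum.mono_neutral_right)
    have "X u v = 0" if "u \<notin> \<Union>\<A>" for u v
      unfolding X_def outside[OF that] by simp
    then show "\<forall>u\<in>UNIV - \<Union>\<A>. (\<Sum>v\<in>UNIV. X u v) = 0"
      by simp
  qed auto
  also have "\<dots> = (\<Sum>B\<in>\<A>. \<Sum>u\<in>B. \<Sum>v\<in>UNIV. X u v)"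
    using sum.Union_disjoint[OF _ disj'] by simp
  also have "\<dots> \<le> (\<Sum>B\<in>\<A>. H * (\<Sum>u\<in>B. \<mu> u * \<bar>g $ u\<bar> powr p))"
    by (intro sum_mono block)
  also have "\<dots> = H * (\<Sum>u\<in>\<Union>\<A>. \<mu> u * \<bar>g $ u\<bar> powr p)"
    using sum.Union_disjoint[OF _ disj', of "\<lambda>u. \<mu> u * \<bar>g $ u\<bar> powr p"] by (simp add: sum_distrib_left)
  also have "(\<Sum>u\<in>\<Union>\<A>. \<mu> u * \<bar>g $ u\<bar> powr p) = (\<Sum>u\<in>UNIV. \<mu> u * \<bar>g $ u\<bar> powr p)"
    by (rule sum.mono_neutral_left) (auto simp: outside)
  finally show ?thesis by simp
qed

lemma rayleigh_block_constant_le: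
  assumes "p > 1" "disjoint \<A>" "{} \<notin> \<A>" "\<And>B. B \<in> \<A> \<Longrightarrow> cut_ratio \<mu> w B \<le> H"
    and "g \<in> block_constant \<A>" "g \<in> p_sphere \<mu> p"
  shows "rayleigh \<mu> w p g \<le> 2 powr (p - 1) * H"
  using block_constant_energy_le[OF assms(1-5)] assms(6) by (simp add: rayleigh_def p_sphere_def)

lemma rayleigh_nonneg: "rayleigh \<mu> w p g \<ge> 0"
  unfolding rayleigh_def
  by (intro mult_nonneg_nonneg divide_nonneg_nonneg sum_nonneg edge_weight_nonneg less_imp_le[OF vertex_weight_pos]) auto

text \<open>
  Every function is constant on the blocks of the partition into singletons.
\<close>

lemma rayleigh_bounded_on_p_sphere:
  assumes "p > 1" "A \<subseteq> p_sphere \<mu> p"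
  shows "bdd_above (rayleigh \<mu> w p ` A)"
proof -
  define \<A> where "\<A> = range (\<lambda>u::'v. {u})"
  have "rayleigh \<mu> w p g \<le> 2 powr (p - 1) * Max (range (cut_ratio \<mu> w))" if "g \<in> A" for g
  proof (rule rayleigh_block_constant_le[OF assms(1)])
    show "disjoint \<A>" "{} \<notin> \<A>"
      by (auto simp: \<A>_def disjoint_def)
    show "g \<in> block_constant \<A>"
      by (rule block_constantI) (auto simp: \<A>_def)
    show "g \<in> p_sphere \<mu> p" using assms that by auto
  qed auto
  then show ?thesis by (intro bdd_aboveI2) auto
qed

text \<open>
  Placing the \<open>i\<close>-th coordinate of a point of the Euclidean sphere on the \<open>i\<close>-th block and rescaling
  to the \<open>p\<close>-sphere is an odd continuous map.
\<close>

lemma genus_block_constant: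
  assumes p: "p > 1" and k: "1 \<le> k" "k \<le> CARD('v)" and fam: "\<A> \<in> disjoint_families k"
  shows "enat k \<le> genus (block_constant \<A> \<inter> p_sphere \<mu> p)"
proof -
  let ?X = "block_constant \<A> \<inter> p_sphere \<mu> p"
  have A: "card \<A> = k" "{} \<notin> \<A>" "disjoint \<A>"
    using fam by (auto simp: disjoint_families_def)
  obtain B where B: "bij_betw B {..<k} \<A>"
    using ex_bij_betw_nat_finite[of \<A>] A(1) by (auto simp: atLeast0LessThan)
  obtain b :: "nat \<Rightarrow> real ^ 'v" where b: "bij_betw b {..<DIM(real ^ 'v)} Basis"
    using ex_bij_betw_nat_finite[of "Basis :: (real ^ 'v) set"] by (auto simp: atLeast0LessThan)
  interpret enumerated_basis b by unfold_locales (rule b)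
  define N where "N = (\<lambda>g::real^'v. \<Sum>u\<in>UNIV. \<mu> u * \<bar>g $ u\<bar> powr p)"
  define q where "q = (\<lambda>x::real^'v. (\<chi> u. \<Sum>i<k. (x \<bullet> b i) * indicator (B i) u) :: real^'v)"
  define e where "e = (\<lambda>x. (N (q x) powr (- 1 / p)) *\<^sub>R q x)"
  have q_on: "q x $ u = x \<bullet> b i" if i: "i < k" and u: "u \<in> B i" for x u i
  proof -
    have "u \<notin> B j" if j: "j < k" "j \<noteq> i" for j
    proof -
      have "B i \<noteq> B j" "B i \<in> \<A>" "B j \<in> \<A>"
        using B i j by (auto simp: bij_betw_def inj_on_def)
      then show ?thesis using A(3) u by (auto simp: disjoint_def)
    qed
    then have "(\<Sum>j<k. (x \<bullet> b j) * indicator (B j) u) = (\<Sum>j\<in>{i}. (x \<bullet> b j) * indicator (B j) u)"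
      using i by (intro sum.mono_neutral_right) (auto simp: indicator_def)
    then show ?thesis using u by (simp add: q_def)
  qed
  have q_block: "q x \<in> block_constant \<A>" for x
  proof -
    have "q x $ u = q x $ v" if C: "C \<in> \<A>" "u \<in> C" "v \<in> C" for C u v
    proof -
      obtain i where "i < k" "C = B i" using B C(1) by (auto simp: bij_betw_def)
      then show ?thesis using q_on C by simp
    qed
    moreover have "q x $ u = 0" if "u \<notin> \<Union>\<A>" for u
    proof -
      have "u \<notin> B i" if "i < k" for i
        using B that \<open>u \<notin> \<Union>\<A>\<close> by (auto simp: bij_betw_def)
      then have "(\<Sum>i<k. (x \<bullet> b i) * indicator (B i) u) = 0"
        by (intro sum.neutral) simp
      then show ?thesis by (simp add: q_def)
    qed
    ultimately show ?thesis by (rule block_constantI)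
  qed
  have q0: "q x \<noteq> 0" if x: "x \<in> coord_sphere k" for x
  proof
    assume q: "q x = 0"
    have "x \<bullet> b i = 0" if "i < DIM(real ^ 'v)" for i
    proof (cases "i < k")
      case True
      then obtain u where "u \<in> B i"
        using B A(2) by (metis bij_betwE ex_in_conv lessThan_iff)
      then show ?thesis using q_on[OF True, of u x] q by simp
    next
      case False
      then show ?thesis using x that by (auto simp: coord_sphere_def coord_space_def)
    qed
    then have "coords x = (\<lambda>i. 0)" by (auto simp: coords_def)
    then have "x = 0" using vec_of_coords[of x] by (simp add: vec_of_def)
    then show False using x by (simp add: coord_sphere_def)
  qed
  have Npos: "N (q x) > 0" if x: "x \<in> coord_sphere k" for x
  proof -
    obtain u where "q x $ u \<noteq> 0"
      using q0[OF x] by (auto simp: vec_eq_iff)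
    then show ?thesis
      unfolding N_def by (rule p_norm_pos)
  qed
  have cont_q: "continuous_on S q" for S
    unfolding q_def by (intro continuous_intros)
  have cont_N: "continuous_on S N" for S
    unfolding N_def using p by (intro p_norm_continuous) auto
  have eX: "e x \<in> ?X" if x: "x \<in> coord_sphere k" for x
  proof -
    have "e x \<in> block_constant \<A>"
      unfolding e_def by (intro subspace_mul subspace_block_constant q_block)
    moreover have "N (e x) = 1"
    proof -
      define c where "c = N (q x) powr (- 1)"
      have "\<bar>e x $ u\<bar> powr p = c * \<bar>q x $ u\<bar> powr p" for u
        using p unfolding c_def by (simp add: e_def abs_mult powr_mult powr_powr)
      then have "N (e x) = c * N (q x)"
        unfolding N_def by (simp add: sum_distrib_left mult_ac)
      then show ?thesis using Npos[OF x] by (simp add: c_def powr_minus)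
    qed
    ultimately show ?thesis by (simp add: p_sphere_def N_def)
  qed
  show ?thesis
  proof (rule genus_ge_of_odd_map[of k e])
    show "continuous_on (coord_sphere k) e"
      unfolding e_def using Npos
      by (intro continuous_intros continuous_on_compose2[OF cont_N cont_q] cont_q) (auto dest!: Npos)
    show "e \<in> coord_sphere k \<rightarrow> ?X" using eX by blast
    have "q (- x) = - q x" for x
      by (simp add: q_def vec_eq_iff sum_negf)
    moreover have "N (- g) = N g" for g by (simp add: N_def)
    ultimately show "e (- x) = - e x" for x by (simp add: e_def)
    have "0 < DIM(real ^ 'v)" using k by simp
    then have "b 0 \<in> coord_sphere k"
      using k inner_b[of 0] b_in_Basis[of 0] by (auto simp: coord_sphere_def coord_space_def)
    then show "?X \<noteq> {}" using eX by blast
  qed (use k in auto)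
qed

text \<open>
  Bounding the infimum by the value at one set requires the suprema to be bounded below, hence that
  each set of the family is nonempty and that the Rayleigh quotient is bounded on it.
\<close>

theorem variational_eigenvalue_le:
  assumes p: "p > 1" and k: "1 \<le> k" "k \<le> CARD('v)"
  shows "variational_eigenvalue \<mu> w p k \<le> 2 powr (p - 1) * isoperimetric_constant \<mu> w k"
proof -
  obtain U :: "'v set" where U: "card U = k"
    using k(2) by (metis obtain_subset_with_card_n)
  have "(\<lambda>u. {u}) ` U \<in> disjoint_families k"
    using U by (auto simp: disjoint_families_def card_image disjoint_def)
  then obtain \<A> where fam: "\<A> \<in> disjoint_families k"
    and H: "isoperimetric_constant \<mu> w k = Max (cut_ratio \<mu> w ` \<A>)"
    using isoperimetric_constant_attained[of k] by blast
  let ?X = "block_constant \<A> \<inter> p_sphere \<mu> p"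
  have A: "{} \<notin> \<A>" "disjoint \<A>"
    using fam by (auto simp: disjoint_families_def)
  have nonempty: "A \<noteq> {}" if "A \<in> genus_family \<mu> p k" for A
    using that k by (auto simp: genus_family_def genus_def zero_enat_def)
  have "uminus ` ?X = ?X"
  proof -
    have "uminus ` ?X \<subseteq> ?X"
      using subspace_neg[OF subspace_block_constant[of \<A>]] by (auto simp: p_sphere_def)
    then show ?thesis by force
  qed
  moreover have "closed ?X"
    using p by (intro closed_Int closed_subspace subspace_block_constant closed_p_sphere) auto
  ultimately have X: "?X \<in> genus_family \<mu> p k"
    using genus_block_constant[OF p k fam] by (simp add: genus_family_def)
  have "(SUP f\<in>A. rayleigh \<mu> w p f) \<ge> 0" if A: "A \<in> genus_family \<mu> p k" for A
  proof -
    obtain g where g: "g \<in> A" using nonempty[OF A] by auto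
    have "0 \<le> rayleigh \<mu> w p g" by (rule rayleigh_nonneg)
    also have "\<dots> \<le> (SUP f\<in>A. rayleigh \<mu> w p f)"
      using A p by (intro cSUP_upper g rayleigh_bounded_on_p_sphere) (auto simp: genus_family_def)
    finally show ?thesis .
  qed
  then have "bdd_below ((\<lambda>A. SUP f\<in>A. rayleigh \<mu> w p f) ` genus_family \<mu> p k)"
    by (intro bdd_belowI2) auto
  then have "variational_eigenvalue \<mu> w p k \<le> (SUP f\<in>?X. rayleigh \<mu> w p f)"
    unfolding variational_eigenvalue_def by (intro cINF_lower X)
  also have "\<dots> \<le> 2 powr (p - 1) * isoperimetric_constant \<mu> w k"
  proof (rule cSUP_least)
    show "?X \<noteq> {}" by (rule nonempty[OF X])
    fix g assume g: "g \<in> ?X"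
    show "rayleigh \<mu> w p g \<le> 2 powr (p - 1) * isoperimetric_constant \<mu> w k"
    proof (rule rayleigh_block_constant_le[OF p A(2,1)])
      show "cut_ratio \<mu> w B \<le> isoperimetric_constant \<mu> w k" if "B \<in> \<A>" for B
        unfolding H using that by (intro Max_ge) auto
    qed (use g in auto)
  qed
  finally show ?thesis .
qed

end

section \<open>The two-sided estimate\<close>

theorem theorem5p1:
  fixes E :: "'v::finite set set"
    and \<mu> :: "'v \<Rightarrow> real"
    and w :: "'v \<Rightarrow> 'v \<Rightarrow> real"
    and p :: real
    and k m :: nat
    and f :: "real ^ 'v"
  assumes "connected_weighted_graph E \<mu> w"
    and "p > 1"
    and "1 \<le> k" and "k \<le> CARD('v)"
    and "is_eigenfunction \<mu> w p (variational_eigenvalue \<mu> w p k) f"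
    and "m = card (strong_nodal_domains E f)"
  shows "2 powr (p - 1) / max_degree_ratio \<mu> w powr (p - 1)
           * (isoperimetric_constant \<mu> w m powr p / p powr p)
         \<le> variational_eigenvalue \<mu> w p k
       \<and> variational_eigenvalue \<mu> w p k
         \<le> 2 powr (p - 1) * isoperimetric_constant \<mu> w k"
proof -
  interpret connected_weighted_graph E \<mu> w by fact
  show ?thesis
    using Cheeger_lower_bound[OF assms(2,5,6)] variational_eigenvalue_le[OF assms(2-4)] ..
qed

end
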